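(* Let $(\Omega,\Sigma,\mu)$ be a probability space and let $(f_n)_{n\ge 1}$ be a sequence of non-negative random variables on $(\Omega,\Sigma,\mu)$. Then there exist a random variable $f$ on $(\Omega,\Sigma,\mu)$ with values in $\mathbb{R}^{+}\cup\{+\infty\}$ and a subsequence $(g_n)_{n\ge 1}$ of $(f_n)_{n\ge 1}$ such that, for every subsequence $(h_n)_{n\ge 1}$ of $(g_n)_{n\ge 1}$ and every permutation $(\pi(1),\pi(2),\dots)$ of $(1,2,\dots)$, $$\lim_{n\to\infty}\frac1n\sum_{k=1}^{n}h_{\pi(k)}=f\qquad \mu\text{-a.e.}$$
   Context: Random variables are real-valued measurable functions unless the value $+\infty$ is explicitly allowed; $\mathbb{R}^{+}=[0,\infty)$. A permutation of $(1,2,\dots)$ is given by a bijection $\pi$ of $\mathbb{N}^{*}=\{1,2,\dots\}$ onto itself. A subsequence is given by a strictly increasing sequence of indices. The limit is taken in $[0,+\infty]$, and the exceptional null set may depend on $(h_n)$ and $\pi$. *)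

theory Defs
  imports "HOL-Probability.Probability"
begin

text \<open>
  Sequences \<open>(s\<^sub>n)\<^sub>n\<^sub>\<ge>\<^sub>1\<close> are functions on \<^typ>\<open>nat\<close> of which only the values at
  indices \<open>n \<ge> 1\<close> are relevant; the value at \<open>0\<close> is unconstrained and never used.
\<close>

definition subsequence_of :: "(nat \<Rightarrow> 'b) \<Rightarrow> (nat \<Rightarrow> 'b) \<Rightarrow> bool" where
  "subsequence_of t s \<longleftrightarrow>
     (\<exists>r. strict_mono_on {1..} r \<and> r ` {1..} \<subseteq> {1..} \<and> (\<forall>n\<ge>1. t n = s (r n)))"

end

theory Submission
  imports Defs "HOL-Real_Asymp.Real_Asymp"
begin

text \<open>
  Along a suitable filter below \<^term>\<open>sequentially\<close>, all truncations \<open>min f\<^sub>n k\<close> converge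
  weakly to functions \<open>\<beta>\<^sub>k\<close>, and the limit of the averages is \<open>G = sup\<^sub>k \<beta>\<^sub>k\<close>. Choose the
  subsequence so that the centred truncations \<open>min g\<^sub>i k - \<beta>\<^sub>k\<close>, \<open>k \<le> i\<close>, of different terms are
  nearly orthogonal. This is a condition on unordered pairs, so it survives subsequences and
  permutations, and Etemadi's proof of the strong law needs, for non-negative variables, only such
  pairwise information.
  With a fixed truncation level it shows that the averages are eventually at least about \<open>\<beta>\<^sub>k\<close> for
  every \<open>k\<close>, which settles the set where \<open>G = \<infinity>\<close>. On \<open>{G < \<infinity>}\<close> it is applied to the weighted
  measure with density \<open>1 / (1 + G)\<close> and to truncation levels growing with the position; a
  Borel-Cantelli argument then removes the truncation.
\<close>

subsection \<open>Weak limits along a filter\<close>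

text \<open>No bound on the integrals of the \<open>f n\<close> is available, so weak compactness is
  used only for bounded truncations, with one limit \<open>\<beta> k\<close> per level. The centring
  depends on the level and not on the term; this is why every subsequence and every permutation has
  the same limit. Near orthogonality costs only a selection: once a term is frozen, its weighted
  centred truncation is a test function against which later centred truncations tend to 0. The
  tolerance for a pair is a product of two summable factors, so the double sum stays bounded in any
  order of the terms.

  The main obstacle is the variance bound of the strong law, since squares do not pass to weak
  limits. Second moments of truncations are therefore bounded by linear combinations of first
  moments at successive levels. The increments of the weighted integral of \<open>\<beta> j\<close>
  from one level to the next stand in for the tail probabilities of an identically distributed
  sequence; for the weight \<open>1 / (1 + G)\<close> their sum is at most 1. They bound both the
  variances and the probabilities in the Borel-Cantelli argument.\<close>

lemma (in finite_measure) ex_weak_limit_density: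
  fixes y :: "'b \<Rightarrow> 'a \<Rightarrow> real" and c :: real
  assumes F: "F \<noteq> bot"
    and y: "\<And>n. y n \<in> borel_measurable M"
    and bnd: "\<And>n x. x \<in> space M \<Longrightarrow> 0 \<le> y n x \<and> y n x \<le> c"
    and conv: "\<And>A. A \<in> sets M \<Longrightarrow> ((\<lambda>n. \<integral>x. indicator A x * y n x \<partial>M) \<longlongrightarrow> L A) F"
  shows "\<exists>b\<in>borel_measurable M. (\<forall>x. b x \<le> c) \<and> (AE x in M. 0 \<le> b x) \<and>
    (\<forall>\<phi>. integrable M \<phi> \<longrightarrow> ((\<lambda>n. \<integral>x. \<phi> x * y n x \<partial>M) \<longlongrightarrow> (\<integral>x. \<phi> x * b x \<partial>M)) F)"
proof -
  note [measurable] = y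
  have int_mult: "integrable M (\<lambda>x. \<phi> x * z x)"
    if \<phi>: "integrable M \<phi>" and [measurable]: "z \<in> borel_measurable M"
      and zb: "AE x in M. \<bar>z x\<bar> \<le> c" for \<phi> z :: "'a \<Rightarrow> real"
  proof (rule Bochner_Integration.integrable_bound)
    show "integrable M (\<lambda>x. \<phi> x * c)" using \<phi> by simp
    show "(\<lambda>x. \<phi> x * z x) \<in> borel_measurable M" using \<phi> by measurable
    show "AE x in M. norm (\<phi> x * z x) \<le> norm (\<phi> x * c)"
      using zb by eventually_elim (auto simp: abs_mult intro!: mult_left_mono)
  qed
  have yabs: "AE x in M. \<bar>y n x\<bar> \<le> c" for n
    using bnd[of _ n] by (intro AE_I2) auto
  have int_y: "integrable M (\<lambda>x. \<phi> x * y n x)" if "integrable M \<phi>" for n \<phi>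
    by (rule int_mult[OF that y yabs])
  have indI: "integrable M (indicat_real A)" if "A \<in> sets M" for A
    using that by (simp add: less_top[symmetric])
  have L0: "0 \<le> L A" if "A \<in> sets M" for A
    by (rule tendsto_lowerbound[OF conv[OF that] _ F])
       (intro always_eventually allI integral_nonneg_AE AE_I2, use bnd in \<open>auto simp: indicator_def\<close>)
  have L1: "L A \<le> c * measure M A" if A: "A \<in> sets M" for A
  proof (rule tendsto_upperbound[OF conv[OF A] _ F], intro always_eventually allI)
    fix n
    have "(\<integral>x. indicator A x * y n x \<partial>M) \<le> (\<integral>x. indicator A x * c \<partial>M)"
      using A bnd by (intro integral_mono int_y integrable_mult_left indI) (auto simp: indicator_def)
    then show "(\<integral>x. indicator A x * y n x \<partial>M) \<le> c * measure M A"
      using A by (simp add: mult.commute)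
  qed
  have Ladd: "L (A \<union> B) = L A + L B" if A: "A \<in> sets M" and B: "B \<in> sets M" and "A \<inter> B = {}" for A B
  proof (rule tendsto_unique[OF F conv])
    have "(\<integral>x. indicator (A \<union> B) x * y n x \<partial>M) =
      (\<integral>x. indicator A x * y n x \<partial>M) + (\<integral>x. indicator B x * y n x \<partial>M)" for n
      by (subst Bochner_Integration.integral_add[symmetric, OF int_y int_y, OF indI indI, OF A B])
         (use that in \<open>auto intro!: Bochner_Integration.integral_cong simp: indicator_def\<close>)
    then show "((\<lambda>n. \<integral>x. indicator (A \<union> B) x * y n x \<partial>M) \<longlongrightarrow> L A + L B) F"
      using tendsto_add[OF conv[OF A] conv[OF B]] by simp
  qed (use that in auto)
  have Lempty: "L {} = 0"
    using L0[of "{}"] L1[of "{}"] by simp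
  define \<nu> where "\<nu> = measure_of (space M) (sets M) (\<lambda>A. ennreal (L A))"
  have pos: "positive (sets M) (\<lambda>A. ennreal (L A))"
    by (simp add: positive_def Lempty)
  \<comment> \<open>Domination by \<open>c * measure M A\<close> turns continuity of
    \<open>M\<close> at the empty set into continuity of \<open>L\<close>, which is all that a
    finite, finitely additive set function lacks.\<close>
  have "countably_additive (sets M) (\<lambda>A. ennreal (L A))"
  proof (rule sets.empty_continuous_imp_countably_additive[OF pos])
    show "additive (sets M) (\<lambda>A. ennreal (L A))"
      by (auto simp: additive_def Ladd L0 ennreal_plus)
    fix A :: "nat \<Rightarrow> 'a set"
    assume A: "range A \<subseteq> sets M" "decseq A" "(\<Inter>i. A i) = {}"
    have "(\<lambda>i. measure M (A i)) \<longlonglongrightarrow> measure M (\<Inter>i. A i)"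
      by (rule finite_Lim_measure_decseq) (use A in auto)
    then have "(\<lambda>i. c * measure M (A i)) \<longlonglongrightarrow> c * 0"
      using A(3) by (intro tendsto_intros) simp
    then have "(\<lambda>i. L (A i)) \<longlonglongrightarrow> 0"
      by (intro tendsto_sandwich[of "\<lambda>_. 0" "\<lambda>i. L (A i)" _ "\<lambda>i. c * measure M (A i)"]
            always_eventually allI L0 L1) (use A(1) in simp_all)
    then show "(\<lambda>i. ennreal (L (A i))) \<longlonglongrightarrow> 0"
      by (metis ennreal_0 tendsto_ennrealI)
  qed simp
  then have em: "emeasure \<nu> A = ennreal (L A)" if "A \<in> sets M" for A
    unfolding \<nu>_def by (intro emeasure_measure_of_sigma pos that) (auto simp: sets.sigma_algebra_axioms)
  have sets_\<nu>: "sets \<nu> = sets M"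
    unfolding \<nu>_def by (simp add: sets.sigma_sets_eq sets.space_closed)
  have "absolutely_continuous M \<nu>"
    unfolding absolutely_continuous_def
  proof
    fix A assume "A \<in> null_sets M"
    then have "A \<in> sets M" "measure M A = 0" by (auto simp: null_sets_def measure_def)
    then show "A \<in> null_sets \<nu>"
      using L0[of A] L1[of A] by (auto simp: null_sets_def sets_\<nu> em)
  qed
  then obtain \<rho> where [measurable]: "\<rho> \<in> borel_measurable M" and \<rho>: "density M \<rho> = \<nu>"
    using Radon_Nikodym[OF _ sets_\<nu>] by auto
  have nn\<rho>: "(\<integral>\<^sup>+x. \<rho> x * indicator A x \<partial>M) = ennreal (L A)" if A: "A \<in> sets M" for A
    using em[OF A] that by (simp add: \<rho>[symmetric] emeasure_density)
  have "(\<integral>\<^sup>+x. \<rho> x \<partial>M) = (\<integral>\<^sup>+x. \<rho> x * indicator (space M) x \<partial>M)"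
    by (rule nn_integral_cong) auto
  then have fin\<rho>: "AE x in M. \<rho> x \<noteq> \<infinity>"
    by (intro nn_integral_PInf_AE) (simp_all only: nn\<rho>[OF sets.top], auto)
  define b where "b x = enn2real (\<rho> x)" for x
  have bm[measurable]: "b \<in> borel_measurable M" unfolding b_def by measurable
  have b0: "0 \<le> b x" for x by (simp add: b_def)
  have nnb: "(\<integral>\<^sup>+x. ennreal (indicator A x * b x) \<partial>M) = ennreal (L A)" if A: "A \<in> sets M" for A
    unfolding nn\<rho>[OF A, symmetric]
    by (rule nn_integral_cong_AE, use fin\<rho> in eventually_elim)
       (auto simp: b_def indicator_def less_top)
  have intb: "integrable M (\<lambda>x. indicator A x * b x)" if A: "A \<in> sets M" for A
    by (rule integrableI_nonneg) (use A b0 nnb in auto)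
  have bL: "(\<integral>x. indicator A x * b x \<partial>M) = L A" if A: "A \<in> sets M" for A
    by (subst integral_eq_nn_integral) (use A b0 nnb L0 in auto)
  have "integrable M b"
    using intb[OF sets.top] by (rule Bochner_Integration.integrable_cong[THEN iffD1, rotated -1]) auto
  then have "AE x in M. 0 \<le> c - b x"
  proof (intro density_nonneg)
    fix A assume A: "A \<in> sets M"
    have "(LINT x:A|M. c - b x) = (\<integral>x. indicator A x * c - indicator A x * b x \<partial>M)"
      by (simp add: set_lebesgue_integral_def algebra_simps)
    also have "\<dots> = c * measure M A - L A"
      by (subst Bochner_Integration.integral_diff) (use A indI[OF A] in \<open>auto simp: intb bL\<close>)
    finally show "0 \<le> (LINT x:A|M. c - b x)" using L1[OF A] by simp
  qed auto
  then have bc: "AE x in M. b x \<le> c" by auto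
  have babs: "AE x in M. \<bar>b x\<bar> \<le> c"
    using bc by eventually_elim (use b0 in auto)
  have int_b: "integrable M (\<lambda>x. \<phi> x * b x)" if "integrable M \<phi>" for \<phi>
    by (rule int_mult[OF that bm babs])
  have main: "((\<lambda>n. \<integral>x. \<phi> x * y n x \<partial>M) \<longlongrightarrow> (\<integral>x. \<phi> x * b x \<partial>M)) F" if "integrable M \<phi>" for \<phi>
    using that
  proof (induction rule: integrable_induct)
    case (base A d)
    from tendsto_mult_left[OF conv[OF base(1)], of d] show ?case
      by (simp add: bL[OF base(1), symmetric] mult.left_commute mult.commute[of _ d] mult.assoc)
  next
    case (add f g)
    from tendsto_add[OF add(3,4)] show ?case
      by (simp add: distrib_right int_y int_b add(1,2))
  next
    case (lim f s)
    have "(\<lambda>i. \<integral>x. \<bar>s i x - f x\<bar> \<partial>M) \<longlonglongrightarrow> (\<integral>x. 0 \<partial>M)"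
    proof (rule integral_dominated_convergence[where w="\<lambda>x. 3 * \<bar>f x\<bar>"])
      show "AE x in M. (\<lambda>i. \<bar>s i x - f x\<bar>) \<longlonglongrightarrow> 0"
        using lim(2) by (intro AE_I2 tendsto_rabs_zero LIM_zero) auto
      show "AE x in M. norm \<bar>s i x - f x\<bar> \<le> 3 * \<bar>f x\<bar>" for i
      proof (rule AE_I2)
        fix x assume "x \<in> space M"
        from lim(3)[OF this, of i] show "norm \<bar>s i x - f x\<bar> \<le> 3 * \<bar>f x\<bar>" by simp
      qed
    qed (use lim(1,4) in auto)
    then have e0: "(\<lambda>i. c * (\<integral>x. \<bar>s i x - f x\<bar> \<partial>M)) \<longlonglongrightarrow> 0"
      using tendsto_mult_left[of _ "0::real" sequentially c] by simp
    \<comment> \<open>The bound depends on \<open>z\<close> only through \<open>c\<close>, hence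
      holds uniformly for all \<open>y n\<close> and for \<open>b\<close>. This uniformity permits
      exchanging the limit in \<open>i\<close> with the limit along \<open>F\<close>.\<close>
    have close: "\<bar>(\<integral>x. s i x * z x \<partial>M) - (\<integral>x. f x * z x \<partial>M)\<bar> \<le> c * (\<integral>x. \<bar>s i x - f x\<bar> \<partial>M)"
      if [measurable]: "z \<in> borel_measurable M" and zb: "AE x in M. \<bar>z x\<bar> \<le> c" for i and z :: "'a \<Rightarrow> real"
    proof -
      have "(\<integral>x. s i x * z x \<partial>M) - (\<integral>x. f x * z x \<partial>M) = (\<integral>x. (s i x - f x) * z x \<partial>M)"
        by (simp add: left_diff_distrib int_mult[OF lim(1) that] int_mult[OF lim(4) that])
      also have "\<bar>\<dots>\<bar> \<le> (\<integral>x. \<bar>(s i x - f x) * z x\<bar> \<partial>M)"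
        by (rule integral_abs_bound)
      also have "\<dots> \<le> (\<integral>x. \<bar>s i x - f x\<bar> * c \<partial>M)"
      proof (rule integral_mono_AE)
        show "AE x in M. \<bar>(s i x - f x) * z x\<bar> \<le> \<bar>s i x - f x\<bar> * c"
          using zb by eventually_elim (simp add: abs_mult mult_left_mono)
      qed (use lim(1,4) in \<open>auto intro!: int_mult[OF _ that]\<close>)
      finally show ?thesis by (simp add: mult.commute)
    qed
    show ?case
    proof (rule swap_uniform_limit'[where g="\<lambda>i. \<integral>x. s i x * b x \<partial>M"])
      show "\<forall>\<^sub>F i in sequentially. ((\<lambda>n. \<integral>x. s i x * y n x \<partial>M) \<longlongrightarrow> (\<integral>x. s i x * b x \<partial>M)) F"
        using lim(5) by (intro always_eventually) auto
      show "(\<lambda>i. \<integral>x. s i x * b x \<partial>M) \<longlonglongrightarrow> (\<integral>x. f x * b x \<partial>M)"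
        by (rule LIM_zero_cancel, rule Lim_null_comparison[OF _ e0])
           (auto intro!: always_eventually close[OF bm babs])
      show "uniform_limit UNIV (\<lambda>i n. \<integral>x. s i x * y n x \<partial>M) (\<lambda>n. \<integral>x. f x * y n x \<partial>M) sequentially"
      proof (rule uniform_limitI)
        fix e :: real assume "e > 0"
        then have "\<forall>\<^sub>F i in sequentially. c * (\<integral>x. \<bar>s i x - f x\<bar> \<partial>M) < e"
          by (rule order_tendstoD(2)[OF e0])
        then show "\<forall>\<^sub>F i in sequentially. \<forall>n\<in>UNIV. dist (\<integral>x. s i x * y n x \<partial>M) (\<integral>x. f x * y n x \<partial>M) < e"
          by eventually_elim (use close[OF y yabs] in \<open>auto simp: dist_real_def intro: le_less_trans\<close>)
      qed
    qed simp_all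
  qed
  \<comment> \<open>Cutting off at \<open>c\<close> alters \<open>b\<close> on a null set only and
    makes the upper bound hold at every point.\<close>
  have "AE x in M. 0 \<le> min c (b x) \<and> min c (b x) = b x"
    using bc by eventually_elim (use b0 in \<open>auto simp: min_def\<close>)
  then have mb: "AE x in M. min c (b x) = b x" "AE x in M. 0 \<le> min c (b x)"
    by auto
  have "(\<integral>x. \<phi> x * min c (b x) \<partial>M) = (\<integral>x. \<phi> x * b x \<partial>M)" if "integrable M \<phi>" for \<phi>
    using that by (intro integral_cong_AE) (use mb(1) in \<open>auto elim!: eventually_mono\<close>)
  then show ?thesis
    using main mb(2) by (intro bexI[of _ "\<lambda>x. min c (b x)"]) auto
qed

lemma compact_PiE_UNIV:
  fixes K :: "'i \<Rightarrow> 'b::topological_space set"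
  assumes "\<And>i. compact (K i)"
  shows "compact (PiE UNIV K)"
proof -
  have "compactin (product_topology (\<lambda>i. euclidean) UNIV) (PiE UNIV K)"
    using assms by (simp add: compactin_PiE)
  then show ?thesis by (simp add: euclidean_product_topology)
qed

text \<open>Restricting to a filter below \<^term>\<open>sequentially\<close> instead of a subsequence lets the
  Tychonoff theorem supply all limits at once, without any separability.\<close>

lemma ex_filter_tendsto_bounded:
  fixes \<Phi> :: "nat \<Rightarrow> 'i \<Rightarrow> real"
  assumes "\<And>n i. i \<in> I \<Longrightarrow> \<bar>\<Phi> n i\<bar> \<le> C i"
  shows "\<exists>F. F \<noteq> bot \<and> F \<le> sequentially \<and> (\<forall>i\<in>I. \<exists>l. ((\<lambda>n. \<Phi> n i) \<longlongrightarrow> l) F)"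
proof -
  \<comment> \<open>Coordinates outside \<open>I\<close>, for which no bound is known, are set to 0,
    so that the whole type \<open>'i\<close> can index one compact box.\<close>
  define \<Psi> where "\<Psi> n i = (if i \<in> I then \<Phi> n i else 0)" for n i
  define K where "K = (PiE UNIV (\<lambda>i. {- \<bar>C i\<bar>..\<bar>C i\<bar>}))"
  have "\<Psi> n \<in> K" for n
  proof -
    have "\<bar>\<Psi> n i\<bar> \<le> \<bar>C i\<bar>" for i
      using assms[of i n] by (auto simp: \<Psi>_def)
    then show ?thesis by (auto simp: K_def PiE_UNIV_domain abs_le_iff minus_le_iff)
  qed
  then have "eventually (\<lambda>x. x \<in> K) (filtermap \<Psi> sequentially)"
    by (simp add: eventually_filtermap)
  moreover have "compact K" unfolding K_def by (rule compact_PiE_UNIV) simp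
  ultimately obtain L where L: "inf (nhds L) (filtermap \<Psi> sequentially) \<noteq> bot"
    unfolding compact_filter by (metis filtermap_bot_iff sequentially_bot)
  \<comment> \<open>Pulling the neighbourhoods of \<open>L\<close> back along \<open>\<Psi>\<close>
    gives a filter of indices along which convergence to \<open>L\<close> holds by construction;
    that \<open>L\<close> is a cluster point is what keeps it proper.\<close>
  define F where "F = inf (filtercomap \<Psi> (nhds L)) sequentially"
  have "F \<noteq> bot"
  proof
    assume "F = bot"
    then have "eventually (\<lambda>_. False) F" by simp
    then obtain P Q where PQ: "eventually P (filtercomap \<Psi> (nhds L))" "eventually Q sequentially"
      "\<And>x. P x \<Longrightarrow> Q x \<Longrightarrow> False"
      unfolding F_def eventually_inf by blast
    then obtain R where R: "eventually R (nhds L)" "\<And>x. R (\<Psi> x) \<Longrightarrow> P x"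
      unfolding eventually_filtercomap by blast
    have "eventually (\<lambda>x. \<not> R x) (filtermap \<Psi> sequentially)"
      unfolding eventually_filtermap using PQ(2) by eventually_elim (use PQ(3) R(2) in blast)
    with R(1) have "eventually (\<lambda>_. False) (inf (nhds L) (filtermap \<Psi> sequentially))"
      unfolding eventually_inf by blast
    with L show False by (simp add: eventually_False)
  qed
  moreover have "((\<lambda>n. \<Phi> n i) \<longlongrightarrow> L i) F" if "i \<in> I" for i
  proof -
    have "(\<Psi> \<longlongrightarrow> L) F"
      unfolding F_def by (simp add: filterlim_inf le_infI1 filterlim_iff_le_filtercomap)
    have "((\<lambda>n. \<Psi> n i) \<longlongrightarrow> L i) F"
    proof (rule topological_tendstoI)
      fix S assume "open S" "L i \<in> S"
      moreover have "continuous_on UNIV (\<lambda>x :: 'i \<Rightarrow> real. x i)"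
        by (rule continuous_on_product_coordinates)
      ultimately have "open ((\<lambda>x :: 'i \<Rightarrow> real. x i) -` S)" "L \<in> (\<lambda>x. x i) -` S"
        using continuous_on_open_vimage[of UNIV "\<lambda>x :: 'i \<Rightarrow> real. x i"] by auto
      from topological_tendstoD[OF \<open>(\<Psi> \<longlongrightarrow> L) F\<close> this] show "\<forall>\<^sub>F n in F. \<Psi> n i \<in> S"
        by simp
    qed
    then show ?thesis using that by (simp add: \<Psi>_def)
  qed
  moreover have "F \<le> sequentially" by (simp add: F_def)
  ultimately show ?thesis by blast
qed

text \<open>Compactness is applied once, with all pairs of a measurable set and an index
  \<open>k\<close> as coordinates, so that a single filter serves every \<open>k\<close>.\<close>

lemma (in finite_measure) ex_weak_limit_filter:
  fixes y :: "nat \<Rightarrow> 'i \<Rightarrow> 'a \<Rightarrow> real" and c :: "'i \<Rightarrow> real"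
  assumes y: "\<And>n k. y n k \<in> borel_measurable M"
    and bnd: "\<And>n k x. x \<in> space M \<Longrightarrow> 0 \<le> y n k x \<and> y n k x \<le> c k"
  obtains F b where "F \<noteq> bot" "F \<le> sequentially" "\<And>k. b k \<in> borel_measurable M"
    "\<And>k x. b k x \<le> c k" "\<And>k. AE x in M. 0 \<le> b k x"
    "\<And>k \<phi>. integrable M \<phi> \<Longrightarrow>
       ((\<lambda>n. \<integral>x. \<phi> x * y n k x \<partial>M) \<longlongrightarrow> (\<integral>x. \<phi> x * b k x \<partial>M)) F"
proof -
  note [measurable] = y
  have "\<bar>\<integral>x. indicator A x * y n k x \<partial>M\<bar> \<le> \<bar>c k\<bar> * measure M (space M)"
    if A[measurable]: "A \<in> sets M" for A n k
  proof -
    have "\<bar>\<integral>x. indicator A x * y n k x \<partial>M\<bar> \<le> (\<integral>x. \<bar>indicator A x * y n k x\<bar> \<partial>M)"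
      by (rule integral_abs_bound)
    also have "\<dots> \<le> (\<integral>x. \<bar>c k\<bar> \<partial>M)"
    proof (rule integral_mono_AE)
      show ae: "AE x in M. \<bar>indicator A x * y n k x\<bar> \<le> \<bar>c k\<bar>"
        by (rule AE_I2) (use bnd[of _ n k] in \<open>force simp: indicator_def\<close>)
      show "integrable M (\<lambda>x. \<bar>indicator A x * y n k x\<bar>)"
        by (rule integrable_const_bound[of _ "\<bar>c k\<bar>"]) (use ae in auto)
    qed simp
    finally show ?thesis by (simp add: mult.commute)
  qed
  then have "\<And>n (i :: 'a set \<times> 'i). i \<in> sets M \<times> UNIV \<Longrightarrow>
      \<bar>\<integral>x. indicator (fst i) x * y n (snd i) x \<partial>M\<bar> \<le> \<bar>c (snd i)\<bar> * measure M (space M)"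
    by auto
  then have "\<exists>F. F \<noteq> bot \<and> F \<le> sequentially \<and> (\<forall>i\<in>sets M \<times> UNIV.
      \<exists>l. ((\<lambda>n. \<integral>x. indicator (fst i) x * y n (snd i) x \<partial>M) \<longlongrightarrow> l) F)"
    by (rule ex_filter_tendsto_bounded)
  then obtain F where F: "F \<noteq> bot" "F \<le> sequentially"
    and lim: "\<forall>i\<in>sets M \<times> UNIV.
      \<exists>l. ((\<lambda>n. \<integral>x. indicator (fst i) x * y n (snd i) x \<partial>M) \<longlongrightarrow> l) F"
    by (elim exE conjE)
  have ex_l: "\<exists>l. ((\<lambda>n. \<integral>x. indicator A x * y n k x \<partial>M) \<longlongrightarrow> l) F" if "A \<in> sets M" for k A
    using bspec[OF lim, of "(A, k)"] that by simp
  define L where "L k A = (SOME l. ((\<lambda>n. \<integral>x. indicator A x * y n k x \<partial>M) \<longlongrightarrow> l) F)" for k A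
  have L: "((\<lambda>n. \<integral>x. indicator A x * y n k x \<partial>M) \<longlongrightarrow> L k A) F" if "A \<in> sets M" for k A
    unfolding L_def by (rule someI_ex[OF ex_l[OF that]])
  have "\<forall>k. \<exists>b\<in>borel_measurable M. (\<forall>x. b x \<le> c k) \<and> (AE x in M. 0 \<le> b x) \<and>
    (\<forall>\<phi>. integrable M \<phi> \<longrightarrow> ((\<lambda>n. \<integral>x. \<phi> x * y n k x \<partial>M) \<longlongrightarrow> (\<integral>x. \<phi> x * b x \<partial>M)) F)"
  proof
    fix k
    show "\<exists>b\<in>borel_measurable M. (\<forall>x. b x \<le> c k) \<and> (AE x in M. 0 \<le> b x) \<and>
      (\<forall>\<phi>. integrable M \<phi> \<longrightarrow> ((\<lambda>n. \<integral>x. \<phi> x * y n k x \<partial>M) \<longlongrightarrow> (\<integral>x. \<phi> x * b x \<partial>M)) F)"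
    proof (rule ex_weak_limit_density[where y = "\<lambda>n. y n k" and c = "c k" and L = "L k"])
      show "F \<noteq> bot" by (rule F)
      show "y n k \<in> borel_measurable M" for n by (rule y)
      show "0 \<le> y n k x \<and> y n k x \<le> c k" if "x \<in> space M" for n x by (rule bnd[OF that])
      show "((\<lambda>n. \<integral>x. indicator A x * y n k x \<partial>M) \<longlongrightarrow> L k A) F" if "A \<in> sets M" for A
        by (rule L[OF that])
    qed
  qed
  from choice[OF this[unfolded Bex_def]] obtain b where b: "\<forall>k. b k \<in> borel_measurable M \<and>
    (\<forall>x. b k x \<le> c k) \<and> (AE x in M. 0 \<le> b k x) \<and>
    (\<forall>\<phi>. integrable M \<phi> \<longrightarrow> ((\<lambda>n. \<integral>x. \<phi> x * y n k x \<partial>M) \<longlongrightarrow> (\<integral>x. \<phi> x * b k x \<partial>M)) F)"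
    by (elim exE)
  show ?thesis
  proof (rule that[OF F])
    fix k
    from spec[OF b, of k] show "b k \<in> borel_measurable M" "\<And>x. b k x \<le> c k" "AE x in M. 0 \<le> b k x"
      "\<And>\<phi>. integrable M \<phi> \<Longrightarrow>
        ((\<lambda>n. \<integral>x. \<phi> x * y n k x \<partial>M) \<longlongrightarrow> (\<integral>x. \<phi> x * b k x \<partial>M)) F"
      by simp_all
  qed
qed

section \<open>Diagonal selection along a filter\<close>

text \<open>At each stage the new index has to meet finitely many conditions, all of which hold
  eventually along \<open>F\<close>. As \<open>F\<close> is proper, some index meets them together,
  and \<open>F \<le> sequentially\<close> lets it exceed its predecessors. \<open>D\<close> receives
  the positions \<open>i\<close>, \<open>n\<close> besides the chosen indices because tolerances
  shrink with the position.\<close>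

lemma ex_strict_mono_select:
  fixes D :: "nat \<Rightarrow> nat \<Rightarrow> nat \<Rightarrow> nat \<Rightarrow> bool"
  assumes F: "F \<noteq> bot" "F \<le> sequentially"
    and E: "\<And>n. eventually (E n) F"
    and D: "\<And>i a n. i < n \<Longrightarrow> eventually (D i a n) F"
  shows "\<exists>s. strict_mono s \<and> (\<forall>n. E n (s n)) \<and> (\<forall>n. \<forall>i<n. D i (s i) n (s n))"
proof -
  define P where "P s n b \<longleftrightarrow> E n b \<and> (\<forall>i<n. s i < b \<and> D i (s i) n b)" for s n b
  have "\<exists>s. \<forall>n. P s n (s n)"
  proof (rule dependent_wf_choice[of "{(i::nat, n). i < n}"])
    show "wf {(i::nat, n). i < n}" by (rule wf_less)
    fix s n
    have "eventually (\<lambda>b. E n b \<and> (\<forall>i\<in>{..<n}. s i < b \<and> D i (s i) n b)) F"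
      using F(2) by (auto simp: eventually_conj_iff eventually_ball_finite_distrib
        intro!: E D filter_leD[OF F(2) eventually_gt_at_top])
    then show "\<exists>r. P s n r"
      using eventually_happens'[OF F(1)] unfolding P_def by fastforce
  qed (auto simp: P_def)
  then obtain s where "\<And>n. P s n (s n)" by blast
  then show ?thesis by (auto simp: P_def strict_mono_def)
qed

subsection \<open>A strong law for quasi-orthogonal non-negative variables\<close>

lemma tendsto_average:
  fixes x :: "nat \<Rightarrow> real"
  assumes "x \<longlonglongrightarrow> B"
  shows "(\<lambda>n. (\<Sum>k=1..n. x k) / real n) \<longlonglongrightarrow> B"
proof (rule LIMSEQ_I)
  fix e :: real assume "e > 0"
  then obtain N where N: "\<And>k. k \<ge> N \<Longrightarrow> \<bar>x k - B\<bar> < e / 2"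
    using LIMSEQ_D[OF assms, of "e / 2"] by (auto simp: real_norm_def)
  define K where "K = (\<Sum>k=1..N. \<bar>x k - B\<bar>)"
  have "(\<lambda>n. K / real n) \<longlonglongrightarrow> 0" by real_asymp
  then have "\<forall>\<^sub>F n in sequentially. K / real n < e / 2"
    using \<open>e > 0\<close> by (intro order_tendstoD(2)) auto
  then obtain N' where N': "\<And>n. n \<ge> N' \<Longrightarrow> K / real n < e / 2"
    by (auto simp: eventually_sequentially)
  show "\<exists>n0. \<forall>n\<ge>n0. norm ((\<Sum>k=1..n. x k) / real n - B) < e"
  proof (intro exI allI impI)
    fix n assume n: "n \<ge> max 1 (max N N')"
    have "(\<Sum>k=1..n. x k) / real n - B = (\<Sum>k=1..n. x k - B) / real n"
      using n by (simp add: sum_subtractf field_simps)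
    also have "\<bar>\<dots>\<bar> \<le> (\<Sum>k=1..n. \<bar>x k - B\<bar>) / real n"
      by (simp add: divide_right_mono)
    also have "(\<Sum>k=1..n. \<bar>x k - B\<bar>) = K + (\<Sum>k=N+1..n. \<bar>x k - B\<bar>)"
      unfolding K_def using n sum.ub_add_nat[of 1 N "\<lambda>k. \<bar>x k - B\<bar>" "n - N"] by simp
    also have "(\<Sum>k=N+1..n. \<bar>x k - B\<bar>) \<le> (\<Sum>k=N+1..n. e / 2)"
      by (intro sum_mono) (use N in \<open>auto intro: less_imp_le\<close>)
    also have "\<dots> \<le> real n * (e / 2)"
      using \<open>e > 0\<close> by (simp add: mult_right_mono)
    also have "(K + real n * (e / 2)) / real n = K / real n + e / 2"
      using n by (simp add: field_simps)
    also have "K / real n < e / 2" by (rule N') (use n in simp)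
    also have "e / 2 + e / 2 = e" by simp
    finally show "norm ((\<Sum>k=1..n. x k) / real n - B) < e"
      by (simp add: divide_right_mono)
  qed
qed

section \<open>Geometric times and Etemadi's interpolation\<close>

text \<open>The times at which Etemadi's argument controls the averages. For \<open>\<alpha>\<close>
  close to 1 the first values coincide, so the sequence is only weakly increasing.\<close>

definition gfloor :: "real \<Rightarrow> nat \<Rightarrow> nat" where
  "gfloor \<alpha> j = nat \<lfloor>\<alpha> ^ j\<rfloor>"

lemma gfloor_bounds:
  assumes "\<alpha> > 1"
  shows "gfloor \<alpha> j \<ge> 1" "real (gfloor \<alpha> j) \<le> \<alpha> ^ j" "\<alpha> ^ j \<le> 2 * real (gfloor \<alpha> j)"
proof -
  have 1: "\<alpha> ^ j \<ge> 1" using assms by simp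
  then have "\<lfloor>\<alpha> ^ j\<rfloor> \<ge> 1" by simp
  then have "real (gfloor \<alpha> j) = of_int \<lfloor>\<alpha> ^ j\<rfloor>" by (simp add: gfloor_def)
  with 1 \<open>\<lfloor>\<alpha> ^ j\<rfloor> \<ge> 1\<close> show "gfloor \<alpha> j \<ge> 1" "real (gfloor \<alpha> j) \<le> \<alpha> ^ j" "\<alpha> ^ j \<le> 2 * real (gfloor \<alpha> j)"
    by (linarith | simp add: gfloor_def)+
qed

lemma gfloor_mono: "\<alpha> > 1 \<Longrightarrow> i \<le> j \<Longrightarrow> gfloor \<alpha> i \<le> gfloor \<alpha> j"
  unfolding gfloor_def by (intro nat_mono floor_mono power_increasing) auto

lemma filterlim_gfloor:
  assumes "\<alpha> > 1"
  shows "filterlim (gfloor \<alpha>) at_top sequentially"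
  unfolding gfloor_def using assms by real_asymp

lemma gfloor_ratio:
  assumes "\<alpha> > 1"
  shows "(\<lambda>j. real (gfloor \<alpha> (Suc j)) / real (gfloor \<alpha> j)) \<longlonglongrightarrow> \<alpha>"
  unfolding gfloor_def using assms by (real_asymp; simp add: exp_minus)


lemma gfloor_cover:
  assumes "\<alpha> > 1" "n \<ge> gfloor \<alpha> J"
  obtains j where "j \<ge> J" "gfloor \<alpha> j \<le> n" "n < gfloor \<alpha> (Suc j)"
proof -
  have "\<exists>i. n < gfloor \<alpha> i"
    using filterlim_gfloor[OF assms(1)]
    by (metis eventually_gt_at_top eventually_sequentially filterlim_iff order_refl)
  define i where "i = (LEAST i. n < gfloor \<alpha> i)"
  have i: "n < gfloor \<alpha> i" unfolding i_def by (rule LeastI_ex) fact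
  have "i > J"
  proof (rule ccontr)
    assume "\<not> i > J"
    then show False using gfloor_mono[OF assms(1), of i J] i assms(2) by simp
  qed
  then obtain j where j: "i = Suc j" "j \<ge> J" by (cases i) auto
  have "\<not> n < gfloor \<alpha> j" by (rule not_less_Least) (use j in \<open>simp flip: i_def\<close>)
  with i j that show ?thesis by (auto simp: not_less)
qed

text \<open>Sums of non-negative terms increase, so between consecutive geometric times the average
  is determined up to the ratio of these times, which tends to \<open>\<alpha>\<close>. All late
  averages thus lie between about \<open>B / \<alpha>\<close> and \<open>B * \<alpha>\<close>, with
  \<open>\<alpha>\<close> as close to 1 as desired. Only the countably many ratios
  \<open>1 + 1 / p\<close> occur, so that exceptional null sets can be united.\<close>

lemma etemadi_interpolation:
  fixes x :: "nat \<Rightarrow> real"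
  assumes x0: "\<And>k. 0 \<le> x k"
    and conv: "\<And>p::nat. (1::nat) \<le> p \<Longrightarrow> (\<lambda>j. (\<Sum>k=1..gfloor (1 + 1 / p) j. x k) / gfloor (1 + 1 / p) j) \<longlonglongrightarrow> B"
  shows "(\<lambda>n. (\<Sum>k=1..n. x k) / real n) \<longlonglongrightarrow> B"
proof (rule LIMSEQ_I)
  fix e :: real assume "e > 0"
  define T where "T n = (\<Sum>k=1..n. x k)" for n
  have T_mono: "T m \<le> T n" if "m \<le> n" for m n
    unfolding T_def using that by (intro sum_mono2) (auto simp: x0)
  have T0: "0 \<le> T n" for n by (simp add: T_def sum_nonneg x0)
  have B0: "B \<ge> 0"
    by (rule LIMSEQ_le_const[OF conv[of 1]]) (auto simp: sum_nonneg x0)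
  \<comment> \<open>This choice makes \<open>(\<alpha> - 1) * B\<close>, which is
    \<open>B / p\<close>, smaller than \<open>e / 2\<close>.\<close>
  obtain p :: nat where p: "p > 2 * B / e" using reals_Archimedean2 by blast
  then have p1: "p \<ge> 1" using B0 \<open>e > 0\<close>
    by (metis One_nat_def Suc_leI divide_nonneg_pos mult_nonneg_nonneg not_gr_zero not_less of_nat_0 zero_le_numeral)
  define \<alpha> where "\<alpha> = 1 + 1 / real p"
  have \<alpha>: "\<alpha> > 1" using p1 by (simp add: \<alpha>_def)
  have gap: "(\<alpha> - 1) * B < e / 2" using p p1 \<open>e > 0\<close> by (simp add: \<alpha>_def field_simps)
  let ?n = "gfloor \<alpha>"
  have n0: "real (?n j) > 0" for j using gfloor_bounds(1)[OF \<alpha>, of j] by simp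
  have c: "(\<lambda>j. T (?n j) / ?n j) \<longlonglongrightarrow> B" using conv[OF p1] by (simp add: T_def \<alpha>_def)
  have up: "(\<lambda>j. T (?n (Suc j)) / ?n j) \<longlonglongrightarrow> B * \<alpha>"
  proof -
    have "(\<lambda>j. (T (?n (Suc j)) / ?n (Suc j)) * (?n (Suc j) / ?n j)) \<longlonglongrightarrow> B * \<alpha>"
      by (intro tendsto_mult LIMSEQ_Suc[OF c] gfloor_ratio[OF \<alpha>])
    then show ?thesis using n0 by (simp add: order.strict_implies_not_eq[symmetric])
  qed
  have lo: "(\<lambda>j. T (?n j) / ?n (Suc j)) \<longlonglongrightarrow> B / \<alpha>"
  proof -
    have "(\<lambda>j. (T (?n j) / ?n j) / (?n (Suc j) / ?n j)) \<longlonglongrightarrow> B / \<alpha>"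
      using \<alpha> by (intro tendsto_divide c gfloor_ratio[OF \<alpha>]) auto
    then show ?thesis using n0 by (simp add: order.strict_implies_not_eq[symmetric])
  qed
  have "B * \<alpha> < B + e" using gap \<open>e > 0\<close> by (simp add: algebra_simps)
  with up have "\<forall>\<^sub>F j in sequentially. T (?n (Suc j)) / ?n j < B + e"
    by (rule order_tendstoD(2))
  moreover have "B - e < B / \<alpha>"
  proof -
    have "B - B / \<alpha> = (\<alpha> - 1) * B / \<alpha>" using \<alpha> by (simp add: field_simps)
    also have "\<dots> \<le> (\<alpha> - 1) * B"
      using \<alpha> B0 mult_left_mono[of 1 \<alpha> "(\<alpha> - 1) * B"] by (simp add: divide_le_eq)
    finally show ?thesis using gap \<open>e > 0\<close> by simp
  qed
  with lo have "\<forall>\<^sub>F j in sequentially. T (?n j) / ?n (Suc j) > B - e"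
    by (rule order_tendstoD(1))
  ultimately have "\<forall>\<^sub>F j in sequentially. T (?n (Suc j)) / ?n j < B + e \<and> T (?n j) / ?n (Suc j) > B - e"
    by eventually_elim simp
  then obtain J where J: "\<And>j. j \<ge> J \<Longrightarrow> T (?n (Suc j)) / ?n j < B + e \<and> T (?n j) / ?n (Suc j) > B - e"
    by (auto simp: eventually_sequentially)
  show "\<exists>n0. \<forall>n\<ge>n0. norm ((\<Sum>k=1..n. x k) / real n - B) < e"
  proof (intro exI allI impI)
    fix n assume n: "n \<ge> ?n J"
    obtain j where j: "j \<ge> J" "?n j \<le> n" "n < ?n (Suc j)"
      by (rule gfloor_cover[OF \<alpha> n])
    have "T n / real n \<le> T (?n (Suc j)) / ?n j"
      using j(2,3) n0[of j] by (intro frac_le T0 T_mono) auto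
    moreover have "T (?n j) / ?n (Suc j) \<le> T n / real n"
      using j(2,3) n0[of j] by (intro frac_le T0 T_mono) auto
    ultimately show "norm ((\<Sum>k=1..n. x k) / real n - B) < e"
      using J[OF j(1)] by (auto simp: T_def abs_less_iff)
  qed
qed

text \<open>The sum starts no earlier than the first \<open>j\<close> with
  \<open>K \<le> \<alpha> ^ j\<close>, where \<open>q ^ j\<close> is at most
  \<open>1 / K\<^sup>2\<close>; the rest is a geometric series.\<close>

lemma sum_geometric_tail_le:
  fixes q :: real and K :: real
  assumes "\<alpha> > 1" "K > 0" "q = 1 / \<alpha>\<^sup>2"
  shows "(\<Sum>j | j < J \<and> K \<le> \<alpha> ^ j. q ^ j) \<le> 1 / (1 - q) / K\<^sup>2"
proof (cases "\<exists>j. K \<le> \<alpha> ^ j")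
  case False
  have "q < 1" using assms by (simp add: one_less_power)
  with False show ?thesis by simp
next
  case True
  have q: "0 < q" "q < 1" using assms by (simp_all add: one_less_power)
  define i where "i = (LEAST j. K \<le> \<alpha> ^ j)"
  have i: "K \<le> \<alpha> ^ i" unfolding i_def by (rule LeastI_ex) fact
  have "(\<Sum>j | j < J \<and> K \<le> \<alpha> ^ j. q ^ j) \<le> (\<Sum>j\<in>{i..<i + J}. q ^ j)"
    using q by (intro sum_mono2) (auto simp: i_def intro: Least_le)
  also have "\<dots> = q ^ i * (\<Sum>j<J. q ^ j)"
    using sum.shift_bounds_nat_ivl[of "\<lambda>j. q ^ j" 0 i J]
    by (simp add: power_add sum_distrib_left mult.commute add.commute atLeast0LessThan)
  also have "\<dots> \<le> q ^ i * (1 / (1 - q))"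
    using q sum_le_suminf[OF summable_geometric[of q], of "{..<J}"] suminf_geometric[of q]
    by (intro mult_left_mono) auto
  also have "\<dots> = 1 / (\<alpha> ^ i)\<^sup>2 * (1 / (1 - q))"
    by (simp add: assms(3) power_one_over power_mult[symmetric] mult.commute)
  also have "\<dots> \<le> 1 / K\<^sup>2 * (1 / (1 - q))"
    using i q assms(1,2)
    by (intro mult_right_mono divide_left_mono power_mono mult_pos_pos zero_less_power) auto
  finally show ?thesis by (simp add: mult.commute)
qed


lemma AE_tendsto_0_of_summable_square:
  fixes Z :: "nat \<Rightarrow> 'a \<Rightarrow> real"
  assumes int: "\<And>j. integrable N (\<lambda>x. (Z j x)\<^sup>2)"
    and summ: "summable (\<lambda>j. \<integral>x. (Z j x)\<^sup>2 \<partial>N)"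
  shows "AE x in N. (\<lambda>j. Z j x) \<longlonglongrightarrow> 0"
proof -
  have "(\<integral>\<^sup>+x. (\<Sum>j. ennreal ((Z j x)\<^sup>2)) \<partial>N) = (\<Sum>j. \<integral>\<^sup>+x. ennreal ((Z j x)\<^sup>2) \<partial>N)"
    using borel_measurable_integrable[OF int] by (intro nn_integral_suminf measurable_compose[OF _ measurable_ennreal])
  also have "\<dots> = (\<Sum>j. ennreal (\<integral>x. (Z j x)\<^sup>2 \<partial>N))"
    by (intro arg_cong[where f=suminf] ext nn_integral_eq_integral int) simp
  also have "\<dots> = ennreal (\<Sum>j. \<integral>x. (Z j x)\<^sup>2 \<partial>N)"
    using summ by (intro suminf_ennreal2) auto
  finally have "(\<integral>\<^sup>+x. (\<Sum>j. ennreal ((Z j x)\<^sup>2)) \<partial>N) \<noteq> \<infinity>" by simp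
  moreover have "(\<lambda>x. \<Sum>j. ennreal ((Z j x)\<^sup>2)) \<in> borel_measurable N"
    using borel_measurable_integrable[OF int]
    by (intro borel_measurable_suminf_order measurable_compose[OF _ measurable_ennreal])
  ultimately have "AE x in N. (\<Sum>j. ennreal ((Z j x)\<^sup>2)) \<noteq> \<infinity>"
    by (rule nn_integral_PInf_AE[rotated])
  then show ?thesis
  proof eventually_elim
    case (elim x)
    then have "summable (\<lambda>j. (Z j x)\<^sup>2)"
      by (intro summable_suminf_not_top) auto
    then have "(\<lambda>j. (Z j x)\<^sup>2) \<longlonglongrightarrow> 0"
      by (rule summable_LIMSEQ_zero)
    then have "(\<lambda>j. \<bar>Z j x\<bar>) \<longlonglongrightarrow> 0"
      using tendsto_real_sqrt[of "\<lambda>j. (Z j x)\<^sup>2" 0 sequentially] by simp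
    then show ?case by (rule tendsto_rabs_zero_cancel)
  qed
qed

text \<open>After exchanging the summations, \<open>v k\<close> carries as weight the sum of inverse
  squares of the geometric times from \<open>k\<close> on, which is of order
  \<open>1 / k\<^sup>2\<close>; over all times it would be of order \<open>1 / k\<close>. The
  constant \<open>C\<close> only meets a convergent geometric series.\<close>

lemma AE_average_gfloor_tendsto_0:
  fixes S :: "nat \<Rightarrow> 'a \<Rightarrow> real"
  assumes \<alpha>: "\<alpha> > 1"
    and int: "\<And>n. integrable N (\<lambda>x. (S n x)\<^sup>2)"
    and bound: "\<And>n. (\<integral>x. (S n x)\<^sup>2 \<partial>N) \<le> (\<Sum>k=1..n. v k) + C"
    and v0: "\<And>k. 0 \<le> v k" and C0: "0 \<le> C"
    and summ: "summable (\<lambda>k. v k / (real k)\<^sup>2)"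
  shows "AE x in N. (\<lambda>j. S (gfloor \<alpha> j) x / gfloor \<alpha> j) \<longlonglongrightarrow> 0"
proof (rule AE_tendsto_0_of_summable_square)
  show "integrable N (\<lambda>x. (S (gfloor \<alpha> j) x / real (gfloor \<alpha> j))\<^sup>2)" for j
    using int[of "gfloor \<alpha> j"] by (simp add: power_divide)
  define q where "q = 1 / \<alpha>\<^sup>2"
  have q: "0 < q" "q < 1" using \<alpha> by (simp_all add: q_def one_less_power)
  let ?n = "gfloor \<alpha>"
  \<comment> \<open>The floor costs at most a factor 2, which becomes 4 after squaring.\<close>
  have inv: "1 / (real (?n j))\<^sup>2 \<le> 4 * q ^ j" for j
  proof -
    have "(\<alpha> ^ j / 2)\<^sup>2 \<le> (real (?n j))\<^sup>2"
      using gfloor_bounds(3)[OF \<alpha>, of j] \<alpha> by (intro power_mono) auto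
    moreover have "(\<alpha> ^ j / 2)\<^sup>2 > 0" using \<alpha> by simp
    ultimately have "1 / (real (?n j))\<^sup>2 \<le> 1 / (\<alpha> ^ j / 2)\<^sup>2"
      by (intro divide_left_mono mult_pos_pos) linarith+
    also have "\<dots> = 4 * q ^ j"
      by (simp add: q_def power_divide power_one_over power_mult[symmetric] mult.commute)
    finally show ?thesis .
  qed
  define I where "I j = (\<integral>x. (S (?n j) x / ?n j)\<^sup>2 \<partial>N)" for j
  have I: "I j \<le> (\<Sum>k=1..?n j. v k) * (4 * q ^ j) + C * (4 * q ^ j)" for j
  proof -
    have "I j = (\<integral>x. (S (?n j) x)\<^sup>2 \<partial>N) * (1 / (real (?n j))\<^sup>2)"
      by (simp add: I_def power_divide)
    also have "\<dots> \<le> ((\<Sum>k=1..?n j. v k) + C) * (4 * q ^ j)"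
      using bound[of "?n j"] inv[of j] C0 v0
      by (intro mult_mono) (auto intro!: sum_nonneg add_nonneg_nonneg)
    finally show ?thesis by (simp add: algebra_simps)
  qed
  define V where "V = (\<Sum>k. v k / (real k)\<^sup>2)"
  have "summable I"
  proof (rule summableI_nonneg_bounded)
    show "0 \<le> I j" for j by (simp add: I_def)
    fix J
    have "(\<Sum>j<J. (\<Sum>k=1..?n j. v k) * (4 * q ^ j))
        = (\<Sum>j<J. \<Sum>k=1..?n J. if k \<le> ?n j then v k * (4 * q ^ j) else 0)"
    proof (rule sum.cong)
      fix j assume "j \<in> {..<J}"
      then have "?n j \<le> ?n J" by (intro gfloor_mono[OF \<alpha>]) auto
      then have "{1..?n j} = {k\<in>{1..?n J}. k \<le> ?n j}" by auto
      then have "(\<Sum>k=1..?n j. v k) = (\<Sum>k=1..?n J. if k \<le> ?n j then v k else 0)"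
        by (simp only: sum.inter_filter finite_atLeastAtMost)
      then show "(\<Sum>k=1..?n j. v k) * (4 * q ^ j)
          = (\<Sum>k=1..?n J. if k \<le> ?n j then v k * (4 * q ^ j) else 0)"
        by (simp add: sum_distrib_right if_distrib[of "\<lambda>t. t * _"] cong: if_cong)
    qed simp
    also have "\<dots> = (\<Sum>k=1..?n J. \<Sum>j<J. if k \<le> ?n j then v k * (4 * q ^ j) else 0)"
      by (rule sum.swap)
    also have "\<dots> \<le> (\<Sum>k=1..?n J. 4 / (1 - q) * (v k / (real k)\<^sup>2))"
    proof (rule sum_mono)
      fix k assume k: "k \<in> {1..?n J}"
      have "(\<Sum>j<J. if k \<le> ?n j then v k * (4 * q ^ j) else 0)
          = (\<Sum>j | j < J \<and> k \<le> ?n j. v k * (4 * q ^ j))"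
        by (subst sum.inter_filter[symmetric]) (auto intro!: sum.cong)
      also have "\<dots> \<le> (\<Sum>j | j < J \<and> real k \<le> \<alpha> ^ j. v k * (4 * q ^ j))"
      proof (rule sum_mono2)
        show "{j. j < J \<and> k \<le> ?n j} \<subseteq> {j. j < J \<and> real k \<le> \<alpha> ^ j}"
          using gfloor_bounds(2)[OF \<alpha>] by (auto intro: order_trans[OF of_nat_mono])
      qed (use q v0 in auto)
      also have "\<dots> = 4 * v k * (\<Sum>j | j < J \<and> real k \<le> \<alpha> ^ j. q ^ j)"
        by (simp add: sum_distrib_left mult_ac)
      also have "\<dots> \<le> 4 * v k * (1 / (1 - q) / (real k)\<^sup>2)"
        using sum_geometric_tail_le[OF \<alpha> _ q_def, of "real k" J] k v0
        by (intro mult_left_mono) auto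
      finally show "(\<Sum>j<J. if k \<le> ?n j then v k * (4 * q ^ j) else 0) \<le> 4 / (1 - q) * (v k / (real k)\<^sup>2)"
        by simp
    qed
    also have "\<dots> \<le> 4 / (1 - q) * V"
      unfolding sum_distrib_left[symmetric] V_def
      using q v0 by (intro mult_left_mono sum_le_suminf summ) auto
    finally have 1: "(\<Sum>j<J. (\<Sum>k=1..?n j. v k) * (4 * q ^ j)) \<le> 4 / (1 - q) * V" .
    have "(\<Sum>j<J. C * (4 * q ^ j)) = 4 * C * (\<Sum>j<J. q ^ j)"
      by (simp add: sum_distrib_left mult_ac)
    also have "\<dots> \<le> 4 * C * (1 / (1 - q))"
      using q C0 sum_le_suminf[OF summable_geometric[of q], of "{..<J}"] suminf_geometric[of q]
      by (intro mult_left_mono) auto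
    finally have 2: "(\<Sum>j<J. C * (4 * q ^ j)) \<le> 4 * C * (1 / (1 - q))" .
    have "sum I {..<J} \<le> (\<Sum>j<J. (\<Sum>k=1..?n j. v k) * (4 * q ^ j)) + (\<Sum>j<J. C * (4 * q ^ j))"
      unfolding sum.distrib[symmetric] by (intro sum_mono I)
    with 1 2 show "sum I {..<J} \<le> 4 / (1 - q) * V + 4 * C * (1 / (1 - q))" by linarith
  qed
  then show "summable (\<lambda>j. \<integral>x. (S (?n j) x / ?n j)\<^sup>2 \<partial>N)" by (simp add: I_def[abs_def])
qed

text \<open>The product form of the cross bound makes the off-diagonal part of the variance at most
  \<open>D\<^sup>2\<close> for every \<open>n\<close>. Monotone interpolation needs non-negative
  terms, which the centred variables are not; so convergence along geometric times is shown for
  \<open>X - b\<close>, the averages of \<open>b\<close> are added back there, and only then are the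
  gaps filled.\<close>

theorem quasi_orthogonal_strong_law:
  fixes X b :: "nat \<Rightarrow> 'a \<Rightarrow> real"
  assumes X0: "\<And>k x. x \<in> space N \<Longrightarrow> 0 \<le> X k x"
    and int: "\<And>k l. integrable N (\<lambda>x. (X k x - b k x) * (X l x - b l x))"
    and sq: "\<And>k. k \<ge> 1 \<Longrightarrow> (\<integral>x. (X k x - b k x)\<^sup>2 \<partial>N) \<le> v k"
    and summ: "summable (\<lambda>k. v k / (real k)\<^sup>2)"
    and cross: "\<And>k l. k \<ge> 1 \<Longrightarrow> l \<ge> 1 \<Longrightarrow> k \<noteq> l \<Longrightarrow>
      \<bar>\<integral>x. (X k x - b k x) * (X l x - b l x) \<partial>N\<bar> \<le> c k * c l"
    and c0: "\<And>k. 0 \<le> c k" and c1: "\<And>n. (\<Sum>k=1..n. c k) \<le> D"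
    and bB: "AE x in N. (\<lambda>n. (\<Sum>k=1..n. b k x) / real n) \<longlonglongrightarrow> B x"
  shows "AE x in N. (\<lambda>n. (\<Sum>k=1..n. X k x) / real n) \<longlonglongrightarrow> B x"
proof -
  define Y where "Y k x = X k x - b k x" for k x
  define S where "S n x = (\<Sum>k=1..n. Y k x)" for n x
  have intY: "integrable N (\<lambda>x. Y k x * Y l x)" for k l using int by (simp add: Y_def)
  have S2: "(S n x)\<^sup>2 = (\<Sum>k=1..n. \<Sum>l=1..n. Y k x * Y l x)" for n x
    by (simp add: S_def power2_eq_square sum_product)
  \<comment> \<open>Nothing is known about the sign of \<open>v 0\<close>, so it is replaced by 0;
    from 1 on, \<open>v k\<close> is non-negative because it bounds the integral of a
    square.\<close>
  define u where "u k = (if k = 0 then 0 else v k)" for k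
  have sqY: "(\<integral>x. Y k x * Y k x \<partial>N) \<le> u k" if "k \<ge> 1" for k
    using sq[OF that] that by (simp add: Y_def power2_eq_square u_def)
  have u0: "0 \<le> u k" for k
    using order_trans[OF Bochner_Integration.integral_nonneg sqY[of k]] by (cases "k = 0") (auto simp: u_def)
  have "AE x in N. (\<lambda>j. S (gfloor \<alpha> j) x / gfloor \<alpha> j) \<longlonglongrightarrow> 0" if "\<alpha> > 1" for \<alpha>
  proof (rule AE_average_gfloor_tendsto_0[OF that])
    show "integrable N (\<lambda>x. (S n x)\<^sup>2)" for n
      unfolding S2 by (intro Bochner_Integration.integrable_sum intY)
    show "0 \<le> u k" for k by (rule u0)
    show "summable (\<lambda>k. u k / (real k)\<^sup>2)"
      using summ by (rule summable_cong[THEN iffD1, rotated]) (auto simp: u_def eventually_sequentially)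
    show "(\<integral>x. (S n x)\<^sup>2 \<partial>N) \<le> (\<Sum>k=1..n. u k) + D\<^sup>2" for n
    proof -
      have "(\<integral>x. (S n x)\<^sup>2 \<partial>N) = (\<Sum>k=1..n. \<Sum>l=1..n. \<integral>x. Y k x * Y l x \<partial>N)"
        unfolding S2 by (simp add: Bochner_Integration.integral_sum intY)
      also have "\<dots> \<le> (\<Sum>k=1..n. \<Sum>l=1..n. (if l = k then u k else 0) + c k * c l)"
      proof (intro sum_mono)
        fix k l assume kl: "k \<in> {1..n}" "l \<in> {1..n}"
        show "(\<integral>x. Y k x * Y l x \<partial>N) \<le> (if l = k then u k else 0) + c k * c l"
        proof (cases "l = k")
          case True
          then show ?thesis
            using kl sqY[of k] by (simp add: add_increasing2)
        next
          case False
          then show ?thesis using kl cross[of k l] by (auto simp: Y_def)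
        qed
      qed
      also have "\<dots> = (\<Sum>k=1..n. u k) + (\<Sum>k=1..n. c k) * (\<Sum>k=1..n. c k)"
        by (simp add: sum.distrib sum_product)
      also have "(\<Sum>k=1..n. c k) * (\<Sum>k=1..n. c k) \<le> D\<^sup>2"
        unfolding power2_eq_square
        using c1[of n] by (intro mult_mono) (auto intro!: sum_nonneg c0 intro: order_trans[OF sum_nonneg])
      finally show ?thesis by simp
    qed
  qed auto
  then have "AE x in N. \<forall>p::nat. (1::nat) \<le> p \<longrightarrow>
      (\<lambda>j. S (gfloor (1 + 1 / p) j) x / gfloor (1 + 1 / p) j) \<longlonglongrightarrow> 0"
    unfolding AE_all_countable by (auto intro!: AE_impI)
  with bB AE_space show ?thesis
  proof eventually_elim
    case (elim x)
    show ?case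
    proof (rule etemadi_interpolation)
      show "0 \<le> X k x" for k using X0 elim(2) by simp
      fix p :: nat assume p: "1 \<le> p"
      let ?n = "gfloor (1 + 1 / real p)"
      have "(\<lambda>j. (\<Sum>k=1..?n j. b k x) / ?n j) \<longlonglongrightarrow> B x"
        by (rule filterlim_compose[OF elim(1) filterlim_gfloor]) (use p in simp)
      from tendsto_add[OF elim(3)[rule_format, OF p] this]
      show "(\<lambda>j. (\<Sum>k=1..?n j. X k x) / ?n j) \<longlonglongrightarrow> B x"
        by (simp add: S_def Y_def sum_subtractf diff_divide_distrib)
    qed
  qed
qed

subsection \<open>Truncations\<close>

lemma (in finite_measure) ex_truncation_limits:
  fixes f :: "nat \<Rightarrow> 'a \<Rightarrow> real"
  assumes [measurable]: "\<And>n. f n \<in> borel_measurable M"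
    and f0: "\<And>n x. x \<in> space M \<Longrightarrow> 0 \<le> f n x"
  obtains F :: "nat filter" and \<beta> :: "nat \<Rightarrow> 'a \<Rightarrow> real"
  where "F \<noteq> bot" "F \<le> sequentially" "\<And>k. \<beta> k \<in> borel_measurable M"
    "\<And>k x. 0 \<le> \<beta> k x" "\<And>k x. \<beta> k x \<le> real k" "\<And>j k x. j \<le> k \<Longrightarrow> \<beta> j x \<le> \<beta> k x"
    "\<And>k \<phi>. integrable M \<phi> \<Longrightarrow>
       ((\<lambda>n. \<integral>x. \<phi> x * min (f n x) (real k) \<partial>M) \<longlongrightarrow> (\<integral>x. \<phi> x * \<beta> k x \<partial>M)) F"
proof -
  have "(\<lambda>x. min (f n x) (real k)) \<in> borel_measurable M"
    "x \<in> space M \<Longrightarrow> 0 \<le> min (f n x) (real k) \<and> min (f n x) (real k) \<le> real k" for n k x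
    using f0 by auto
  from ex_weak_limit_filter[of "\<lambda>n k x. min (f n x) (real k)" real, OF this]
  obtain F b where F: "F \<noteq> bot" "F \<le> sequentially"
    and b[measurable]: "\<And>k. b k \<in> borel_measurable M"
    and bk: "\<And>k x. b k x \<le> real k" and b0: "\<And>k. AE x in M. 0 \<le> b k x"
    and lim: "\<And>k \<phi>. integrable M \<phi> \<Longrightarrow>
       ((\<lambda>n. \<integral>x. \<phi> x * min (f n x) (real k) \<partial>M) \<longlongrightarrow> (\<integral>x. \<phi> x * b k x \<partial>M)) F"
    by blast
  have int_b: "integrable M (b k)" for k
    by (rule integrable_const_bound[of _ "real k"])
       (use b0[of k] bk[of k] in \<open>auto elim!: eventually_mono\<close>)
  \<comment> \<open>Indicators as test functions carry the inequality between the truncations to the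
    limits, integrated over each measurable set; this yields it almost everywhere.\<close>
  have "AE x in M. 0 \<le> b k x - b j x" if "j \<le> k" for j k
  proof (rule density_nonneg)
    show "integrable M (\<lambda>x. b k x - b j x)" by (intro Bochner_Integration.integrable_diff int_b)
    fix A assume A[measurable]: "A \<in> sets M"
    then have A': "integrable M (indicat_real A)" by (simp add: less_top[symmetric])
    have int_min: "integrable M (\<lambda>x. indicat_real A x * min (f n x) (real i))" for n i
      by (rule integrable_const_bound[of _ "real i"])
         (auto intro!: AE_I2 simp: indicator_def f0)
    have "(\<integral>x. indicator A x * b j x \<partial>M) \<le> (\<integral>x. indicator A x * b k x \<partial>M)"
      by (rule tendsto_le[OF F(1) lim[OF A'] lim[OF A']], intro always_eventually allI integral_mono int_min)
         (use that in \<open>auto simp: indicator_def\<close>)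
    then show "0 \<le> (LINT x:A|M. b k x - b j x)"
      using integrable_mult_indicator[OF A int_b[of k]] integrable_mult_indicator[OF A int_b[of j]]
      by (simp add: set_lebesgue_integral_def right_diff_distrib)
  qed
  then have mono: "AE x in M. \<forall>k. \<forall>j\<in>{..k}. b j x \<le> b k x"
    by (auto simp: AE_all_countable AE_ball_countable)
  \<comment> \<open>The running maximum makes the a.e. bounds and the a.e. monotonicity hold everywhere.\<close>
  define \<beta> where "\<beta> k x = Max ((\<lambda>j. max 0 (b j x)) ` {..k})" for k x
  have "AE x in M. \<forall>k. 0 \<le> b k x" using b0 by (simp add: AE_all_countable)
  with mono have eq: "AE x in M. \<beta> k x = b k x" for k
  proof eventually_elim
    case (elim x)
    show ?case unfolding \<beta>_def by (rule Max_eqI) (use elim in \<open>auto simp: max_def\<close>)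
  qed
  have \<beta>[measurable]: "\<beta> k \<in> borel_measurable M" for k
    unfolding \<beta>_def by measurable
  show ?thesis
  proof (rule that[OF F \<beta>])
    show "0 \<le> \<beta> k x" for k x
      unfolding \<beta>_def by (rule order_trans[OF _ Max_ge[of _ "max 0 (b 0 x)"]]) auto
    show "\<beta> k x \<le> real k" for k x
      unfolding \<beta>_def by (auto intro: order_trans[OF bk])
    show "\<beta> j x \<le> \<beta> k x" if "j \<le> k" for j k x
      unfolding \<beta>_def by (rule Max_mono) (use that in auto)
    fix k and \<phi> :: "'a \<Rightarrow> real" assume \<phi>: "integrable M \<phi>"
    then have "(\<integral>x. \<phi> x * \<beta> k x \<partial>M) = (\<integral>x. \<phi> x * b k x \<partial>M)"
      by (intro integral_cong_AE) (use eq[of k] in \<open>auto elim!: eventually_mono\<close>)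
    with lim[OF \<phi>] show "((\<lambda>n. \<integral>x. \<phi> x * min (f n x) (real k) \<partial>M) \<longlongrightarrow> (\<integral>x. \<phi> x * \<beta> k x \<partial>M)) F"
      by simp
  qed
qed

section \<open>Second moments through first moments of truncations\<close>

text \<open>A discrete form of integrating \<open>2 * t\<close>: each step adds
  \<open>(a (Suc j) + a j) * (a (Suc j) - a j)\<close>, whose first factor is at most
  \<open>2 * Suc j\<close>. The right side is linear in \<open>a\<close>, so its integral is
  accessible to weak limits, unlike that of the square.\<close>

lemma square_le_sum_increments:
  fixes a :: "nat \<Rightarrow> real"
  assumes "\<And>j. 0 \<le> a j" "\<And>j. a j \<le> real j" "\<And>j. a j \<le> a (Suc j)"
  shows "(a m)\<^sup>2 \<le> (\<Sum>j<m. 2 * real (Suc j) * (a (Suc j) - a j))"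
proof (induction m)
  case 0
  have "a 0 = 0" using assms(1,2)[of 0] by simp
  then show ?case by simp
next
  case (Suc m)
  have "(a (Suc m))\<^sup>2 = (a m)\<^sup>2 + (a (Suc m) + a m) * (a (Suc m) - a m)"
    by (simp add: power2_eq_square algebra_simps)
  also have "(a (Suc m) + a m) * (a (Suc m) - a m) \<le> 2 * real (Suc m) * (a (Suc m) - a m)"
    using assms(2)[of m] assms(2)[of "Suc m"] assms(3)[of m] by (intro mult_right_mono) auto
  finally show ?case using Suc by simp
qed

lemma sum_inverse_squares_le: "a \<ge> 1 \<Longrightarrow> (\<Sum>k=a..K. 1 / (real k)\<^sup>2) \<le> 2 / real a"
proof (cases "a \<le> K")
  case True
  assume a: "a \<ge> 1"
  \<comment> \<open>The telescoping difference equals \<open>2 / (k * (k + 1))\<close>, and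
    \<open>k + 1 \<le> 2 * k\<close>.\<close>
  have "(\<Sum>k=a..K. 1 / (real k)\<^sup>2) \<le> (\<Sum>k=a..K. (- 2 / real (Suc k)) - (- 2 / real k))"
  proof (rule sum_mono)
    fix k assume "k \<in> {a..K}"
    then have k: "real k \<ge> 1" using a by simp
    then have "(- 2 / real (Suc k)) - (- 2 / real k) - 1 / (real k)\<^sup>2
        = (real k - 1) / ((real k)\<^sup>2 * real (Suc k))"
      by (simp add: divide_simps power2_eq_square)
    also have "\<dots> \<ge> 0" using k by simp
    finally show "1 / (real k)\<^sup>2 \<le> (- 2 / real (Suc k)) - (- 2 / real k)" by simp
  qed
  also have "\<dots> = 2 / real a - 2 / real (Suc K)"
    using True by (subst sum_Suc_diff) auto
  finally show ?thesis by (simp add: order_trans)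
qed auto

text \<open>With \<open>\<gamma> j\<close> in the role of the tail probability beyond
  \<open>j\<close>, this is the classical summability of truncated second moments over
  \<open>k\<^sup>2\<close> for a variable of finite mean. Exchanging the sums leaves for each
  \<open>j\<close> the factor \<open>2 * Suc j\<close> times a tail of inverse squares, at most
  \<open>2 / Suc j\<close>.\<close>

lemma summable_weighted_increments:
  fixes \<gamma> :: "nat \<Rightarrow> real"
  assumes \<gamma>0: "\<And>j. 0 \<le> \<gamma> j" and bound: "\<And>n. (\<Sum>j<n. \<gamma> j) \<le> C"
  shows "summable (\<lambda>k. (\<Sum>j<k. 2 * real (Suc j) * \<gamma> j) / (real k)\<^sup>2)"
proof (rule summableI_nonneg_bounded)
  fix K
  have "(\<Sum>k<K. (\<Sum>j<k. 2 * real (Suc j) * \<gamma> j) / (real k)\<^sup>2)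
    = (\<Sum>k<K. \<Sum>j | j \<in> {..<K} \<and> j < k. 2 * real (Suc j) * \<gamma> j * (1 / (real k)\<^sup>2))"
    unfolding sum_divide_distrib by (intro sum.cong) auto
  also have "\<dots> = (\<Sum>j<K. \<Sum>k | k \<in> {..<K} \<and> j < k. 2 * real (Suc j) * \<gamma> j * (1 / (real k)\<^sup>2))"
    by (rule sum.swap_restrict) auto
  also have "\<dots> \<le> (\<Sum>j<K. 4 * \<gamma> j)"
  proof (rule sum_mono)
    fix j
    have "(\<Sum>k | k \<in> {..<K} \<and> j < k. 2 * real (Suc j) * \<gamma> j * (1 / (real k)\<^sup>2))
        = 2 * real (Suc j) * \<gamma> j * (\<Sum>k | k \<in> {..<K} \<and> j < k. 1 / (real k)\<^sup>2)"
      by (simp add: sum_distrib_left)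
    also have "\<dots> \<le> 2 * real (Suc j) * \<gamma> j * (2 / real (Suc j))"
    proof (rule mult_left_mono)
      have "(\<Sum>k | k \<in> {..<K} \<and> j < k. 1 / (real k)\<^sup>2) \<le> (\<Sum>k=Suc j..K. 1 / (real k)\<^sup>2)"
        by (intro sum_mono2) auto
      also have "\<dots> \<le> 2 / real (Suc j)" by (rule sum_inverse_squares_le) simp
      finally show "(\<Sum>k | k \<in> {..<K} \<and> j < k. 1 / (real k)\<^sup>2) \<le> 2 / real (Suc j)" .
    qed (use \<gamma>0[of j] in simp)
    also have "\<dots> = 4 * \<gamma> j" by (simp del: of_nat_Suc)
    finally show "(\<Sum>k | k \<in> {..<K} \<and> j < k. 2 * real (Suc j) * \<gamma> j * (1 / (real k)\<^sup>2)) \<le> 4 * \<gamma> j" .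
  qed
  also have "\<dots> \<le> 4 * C" using bound[of K] by (simp flip: sum_distrib_left)
  finally show "(\<Sum>k<K. (\<Sum>j<k. 2 * real (Suc j) * \<gamma> j) / (real k)\<^sup>2) \<le> 4 * C" .
qed (auto intro!: sum_nonneg divide_nonneg_nonneg mult_nonneg_nonneg \<gamma>0)

section \<open>Rearrangement by injections\<close>

lemma filterlim_inj_on_at_top:
  fixes \<sigma> :: "nat \<Rightarrow> nat"
  assumes "inj_on \<sigma> {1..}"
  shows "filterlim \<sigma> at_top sequentially"
  unfolding filterlim_at_top
proof
  fix Z
  have "finite (\<sigma> -` {..<Z} \<inter> {1..})" by (rule finite_vimage_IntI[OF _ assms]) simp
  then obtain K where K: "\<forall>k\<in>\<sigma> -` {..<Z} \<inter> {1..}. k \<le> K"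
    using finite_nat_set_iff_bounded_le by blast
  have "Z \<le> \<sigma> k" if k: "k \<ge> Suc K" for k
  proof (rule ccontr)
    assume "\<not> Z \<le> \<sigma> k"
    then have "k \<in> \<sigma> -` {..<Z} \<inter> {1..}" using that by simp
    with K have "k \<le> K" by blast
    with k show False by simp
  qed
  then show "\<forall>\<^sub>F k in sequentially. Z \<le> \<sigma> k" unfolding eventually_sequentially by blast
qed

text \<open>An injection lists each term of a non-negative series at most once; so one bound on the
  errors holds for all subsequences and permutations.\<close>

lemma sum_inj_on_le_suminf:
  fixes c :: "nat \<Rightarrow> real" and \<sigma> :: "nat \<Rightarrow> nat"
  assumes "inj_on \<sigma> {1..}" "summable c" "\<And>i. 0 \<le> c i"
  shows "(\<Sum>k=1..n. c (\<sigma> k)) \<le> suminf c"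
proof -
  have "inj_on \<sigma> {1..n}" using assms(1) by (rule inj_on_subset) auto
  then have "(\<Sum>k=1..n. c (\<sigma> k)) = sum c (\<sigma> ` {1..n})" by (simp add: sum.reindex)
  also have "\<dots> \<le> suminf c" using assms(2,3) by (intro sum_le_suminf finite_imageI finite_atLeastAtMost) auto
  finally show ?thesis .
qed

section \<open>Weighted strong laws for a selected sequence\<close>

text \<open>The weight \<open>u\<close> is a parameter because it is instantiated both with the
  constant 1 and with a weight concentrated where the limit is finite. In \<open>orth\<close> the
  levels stop at the index, since only finitely many conditions can be imposed when a term is
  selected.\<close>

locale orthogonal_truncations = prob_space M for M :: "'a measure" +
  fixes g \<beta> :: "nat \<Rightarrow> 'a \<Rightarrow> real" and u :: "'a \<Rightarrow> real"
  assumes g_meas[measurable]: "\<And>n. g n \<in> borel_measurable M"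
    and g_nonneg: "\<And>n x. x \<in> space M \<Longrightarrow> 0 \<le> g n x"
    and \<beta>_meas[measurable]: "\<And>k. \<beta> k \<in> borel_measurable M"
    and \<beta>_nonneg: "\<And>k x. 0 \<le> \<beta> k x" and \<beta>_le: "\<And>k x. \<beta> k x \<le> real k"
    and \<beta>_mono: "\<And>j k x. j \<le> k \<Longrightarrow> \<beta> j x \<le> \<beta> k x"
    and u_meas[measurable]: "u \<in> borel_measurable M"
    and u_nonneg: "\<And>x. 0 \<le> u x" and u_le: "\<And>x. u x \<le> 1"
    and orth: "\<And>i n k l. i < n \<Longrightarrow> k \<le> i \<Longrightarrow> l \<le> n \<Longrightarrow>
      \<bar>\<integral>x. u x * ((min (g i x) (real k) - \<beta> k x) * (min (g n x) (real l) - \<beta> l x)) \<partial>M\<bar>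
        \<le> (1 / 2) ^ i * (1 / 2) ^ n"
begin

lemma integrable_weighted:
  assumes [measurable]: "z \<in> borel_measurable M" and "\<And>x. x \<in> space M \<Longrightarrow> \<bar>z x\<bar> \<le> K"
  shows "integrable M (\<lambda>x. u x * z x)"
proof (rule integrable_const_bound[of _ K])
  show "AE x in M. norm (u x * z x) \<le> K"
  proof (rule AE_I2)
    fix x assume "x \<in> space M"
    with assms(2)[of x] mult_mono[of "u x" 1 "\<bar>z x\<bar>" K] show "norm (u x * z x) \<le> K"
      using u_nonneg[of x] u_le[of x] by (simp add: abs_mult)
  qed
qed simp

lemma abs_diff_truncation_le: "x \<in> space M \<Longrightarrow> \<bar>min (g n x) (real k) - \<beta> k x\<bar> \<le> real k"
  using g_nonneg[of x n] \<beta>_nonneg[of k x] \<beta>_le[of k x] by (auto simp: abs_le_iff min_def)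

lemma diff_truncation_square_le:
  "x \<in> space M \<Longrightarrow> (min (g n x) (real k) - \<beta> k x)\<^sup>2 \<le> (real k)\<^sup>2"
  using abs_diff_truncation_le[of x n k] by (subst power2_le_iff_abs_le) auto

text \<open>The weight becomes a density, so that almost everywhere for the new measure means almost
  everywhere on the set \<open>0 < u x\<close>. Distinct positions have distinct indices
  \<open>\<sigma> k\<close>, \<open>\<sigma> l\<close>, and \<open>orth\<close> is applied with the
  smaller one first, whichever position it occupies.\<close>

lemma truncated_strong_law:
  assumes \<sigma>: "inj_on \<sigma> {1..}" and m: "\<And>k. m k \<le> \<sigma> k"
    and sq: "\<And>k. k \<ge> 1 \<Longrightarrow>
      (\<integral>x. u x * (min (g (\<sigma> k) x) (real (m k)) - \<beta> (m k) x)\<^sup>2 \<partial>M) \<le> v k"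
    and summ: "summable (\<lambda>k. v k / (real k)\<^sup>2)"
    and conv: "\<And>x. x \<in> space M \<Longrightarrow> 0 < u x \<Longrightarrow> (\<lambda>k. \<beta> (m k) x) \<longlonglongrightarrow> B x"
  shows "AE x in M. 0 < u x \<longrightarrow>
    (\<lambda>n. (\<Sum>k=1..n. min (g (\<sigma> k) x) (real (m k))) / real n) \<longlonglongrightarrow> B x"
proof -
  let ?N = "density M (\<lambda>x. ennreal (u x))"
  let ?Y = "\<lambda>k x. min (g (\<sigma> k) x) (real (m k)) - \<beta> (m k) x"
  have N: "(\<integral>x. z x \<partial>?N) = (\<integral>x. u x * z x \<partial>M)" if [measurable]: "z \<in> borel_measurable M" for z :: "'a \<Rightarrow> real"
    by (subst integral_density) (auto simp: u_nonneg)
  have cross: "\<bar>\<integral>x. ?Y k x * ?Y l x \<partial>?N\<bar> \<le> (1 / 2) ^ \<sigma> k * (1 / 2) ^ \<sigma> l"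
    if "k \<ge> 1" "l \<ge> 1" "k \<noteq> l" for k l
  proof -
    have "\<sigma> k \<noteq> \<sigma> l" using \<sigma> that by (auto dest: inj_onD)
    then consider "\<sigma> k < \<sigma> l" | "\<sigma> l < \<sigma> k" by linarith
    then show ?thesis
    proof cases
      case 1
      with orth[OF 1 m m] show ?thesis by (simp add: N)
    next
      case 2
      with orth[OF 2 m m] show ?thesis by (simp add: N mult.commute)
    qed
  qed
  have "AE x in ?N. (\<lambda>n. (\<Sum>k=1..n. min (g (\<sigma> k) x) (real (m k))) / real n) \<longlonglongrightarrow> B x"
  proof (rule quasi_orthogonal_strong_law[OF _ _ _ summ cross])
    show "x \<in> space ?N \<Longrightarrow> 0 \<le> min (g (\<sigma> k) x) (real (m k))" for k x
      using g_nonneg by simp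
    show "integrable ?N (\<lambda>x. ?Y k x * ?Y l x)" for k l
    proof -
      have "integrable M (\<lambda>x. u x * (?Y k x * ?Y l x))"
        by (rule integrable_weighted[of _ "real (m k) * real (m l)"])
           (auto simp: abs_mult intro!: mult_mono abs_diff_truncation_le)
      then show ?thesis by (subst integrable_density) (auto simp: u_nonneg)
    qed
    show "(\<integral>x. (?Y k x)\<^sup>2 \<partial>?N) \<le> v k" if "k \<ge> 1" for k
      using sq[OF that] by (simp add: N)
    show "(\<Sum>k=1..n. (1 / 2) ^ \<sigma> k) \<le> suminf (\<lambda>i. (1 / 2 :: real) ^ i)" for n
      by (rule sum_inj_on_le_suminf[OF \<sigma>]) (auto intro: summable_geometric)
    show "AE x in ?N. (\<lambda>n. (\<Sum>k=1..n. \<beta> (m k) x) / real n) \<longlonglongrightarrow> B x"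
      by (subst AE_density) (simp, intro AE_I2 impI tendsto_average conv, simp_all)
  qed simp_all
  then show ?thesis by (subst (asm) AE_density) auto
qed

text \<open>\<open>orth\<close> admits level \<open>m\<close> only for indices from \<open>m\<close>
  on, hence the level \<open>min m (\<sigma> k)\<close>. An injection tends to infinity, so this is
  \<open>m\<close> at all but finitely many positions, and the variances are bounded by a
  constant.\<close>

lemma fixed_level_law:
  assumes \<sigma>: "inj_on \<sigma> {1..}"
  shows "AE x in M. 0 < u x \<longrightarrow>
    (\<lambda>n. (\<Sum>k=1..n. min (g (\<sigma> k) x) (real (min m (\<sigma> k)))) / real n) \<longlonglongrightarrow> \<beta> m x"
proof (rule truncated_strong_law[OF \<sigma>])
  show "(\<integral>x. u x * (min (g (\<sigma> k) x) (real (min m (\<sigma> k))) - \<beta> (min m (\<sigma> k)) x)\<^sup>2 \<partial>M) \<le> (real m)\<^sup>2" for k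
  proof -
    let ?Y = "\<lambda>x. min (g (\<sigma> k) x) (real (min m (\<sigma> k))) - \<beta> (min m (\<sigma> k)) x"
    have Y: "(?Y x)\<^sup>2 \<le> (real m)\<^sup>2" if "x \<in> space M" for x
      using diff_truncation_square_le[OF that, of "\<sigma> k" "min m (\<sigma> k)"]
      by (rule order_trans) (intro power_mono, simp_all)
    have "(\<integral>x. u x * (?Y x)\<^sup>2 \<partial>M) \<le> (\<integral>x. (real m)\<^sup>2 \<partial>M)"
    proof (rule integral_mono)
      show "integrable M (\<lambda>x. u x * (?Y x)\<^sup>2)"
        by (rule integrable_weighted[of _ "(real m)\<^sup>2"]) (use Y in auto)
      show "u x * (?Y x)\<^sup>2 \<le> (real m)\<^sup>2" if "x \<in> space M" for x
        using mult_mono[OF u_le Y[OF that], of x] by simp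
    qed simp
    then show ?thesis by (simp add: prob_space)
  qed
  show "summable (\<lambda>k. (real m)\<^sup>2 / (real k)\<^sup>2)"
    using summable_mult[OF inverse_power_summable[of 2, where 'a=real], of "(real m)\<^sup>2"]
    by (simp add: field_simps)
  have "\<forall>\<^sub>F k in sequentially. m \<le> \<sigma> k"
    using filterlim_inj_on_at_top[OF \<sigma>] by (auto simp: filterlim_at_top)
  then show "(\<lambda>k. \<beta> (min m (\<sigma> k)) x) \<longlonglongrightarrow> \<beta> m x" for x
    by (intro tendsto_eventually) (auto elim!: eventually_mono simp: min_def)
qed simp

text \<open>\<open>bound\<close> replaces a finite mean, and \<open>close\<close> transfers it from
  the weak limits to the individual terms, up to levels not exceeding their index.\<close>

lemma untruncated_strong_law:
  assumes \<sigma>: "inj_on \<sigma> {1..}"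
    and bound: "\<And>k. (\<integral>x. u x * \<beta> k x \<partial>M) \<le> C"
    and close: "\<And>n j. j \<le> n \<Longrightarrow>
      \<bar>(\<integral>x. u x * min (g n x) (real j) \<partial>M) - (\<integral>x. u x * \<beta> j x \<partial>M)\<bar> \<le> (1 / 2) ^ n / (real (Suc n))\<^sup>2"
    and conv: "\<And>x. x \<in> space M \<Longrightarrow> 0 < u x \<Longrightarrow> (\<lambda>k. \<beta> k x) \<longlonglongrightarrow> B x"
  shows "AE x in M. 0 < u x \<longrightarrow> (\<lambda>n. (\<Sum>k=1..n. g (\<sigma> k) x) / real n) \<longlonglongrightarrow> B x"
proof -
  \<comment> \<open>In the second moment of a truncation, at most \<open>n\<close> increments with
    factors of order \<open>n\<close> each carry an error of order \<open>\<epsilon> n\<close>; the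
    squared denominator absorbs this. The power of \<open>1 / 2\<close> keeps the errors summable in
    the Borel-Cantelli step.\<close>
  define \<epsilon> where "\<epsilon> n = (1 / 2 :: real) ^ n / (real (Suc n))\<^sup>2" for n
  define \<gamma> where "\<gamma> j = (\<integral>x. u x * \<beta> (Suc j) x \<partial>M) - (\<integral>x. u x * \<beta> j x \<partial>M)" for j
  define H where "H k = (\<Sum>j<k. 2 * real (Suc j) * \<gamma> j)" for k
  \<comment> \<open>Selection only controls truncation levels up to the index \<open>\<sigma> k\<close>, whereas Etemadi's
    variance bound wants levels at most the position \<open>k\<close>.\<close>
  define m where "m k = min k (\<sigma> k)" for k
  have int_\<beta>: "integrable M (\<lambda>x. u x * \<beta> j x)" for j
    by (rule integrable_weighted[of _ "real j"]) (auto simp: \<beta>_nonneg \<beta>_le)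
  have int_g: "integrable M (\<lambda>x. u x * min (g n x) (real j))" for n j
    by (rule integrable_weighted[of _ "real j"]) (auto simp: g_nonneg)
  have int_\<beta>2: "integrable M (\<lambda>x. u x * (\<beta> j x)\<^sup>2)" for j
    by (rule integrable_weighted[of _ "(real j)\<^sup>2"]) (auto simp: \<beta>_nonneg \<beta>_le intro!: power_mono)
  have int_g2: "integrable M (\<lambda>x. u x * (min (g n x) (real j))\<^sup>2)" for n j
    by (rule integrable_weighted[of _ "(real j)\<^sup>2"]) (auto simp: g_nonneg intro!: power_mono)
  have \<gamma>0: "0 \<le> \<gamma> j" for j
    unfolding \<gamma>_def
    by (simp, intro integral_mono int_\<beta> mult_left_mono \<beta>_mono u_nonneg) simp
  have sum_\<gamma>: "(\<Sum>j<n. \<gamma> j) \<le> C" for n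
  proof -
    have "(\<Sum>j<n. \<gamma> j) = (\<integral>x. u x * \<beta> n x \<partial>M) - (\<integral>x. u x * \<beta> 0 x \<partial>M)"
      unfolding \<gamma>_def by (rule sum_lessThan_telescope)
    moreover have "(\<integral>x. u x * \<beta> 0 x \<partial>M) \<ge> 0" by (simp add: u_nonneg \<beta>_nonneg)
    ultimately show ?thesis using bound[of n] by linarith
  qed
  have summable_\<gamma>: "summable \<gamma>" by (rule summableI_nonneg_bounded[OF \<gamma>0 sum_\<gamma>])
  have \<epsilon>0: "0 \<le> \<epsilon> n" for n by (simp add: \<epsilon>_def)
  have \<epsilon>_le: "\<epsilon> n \<le> (1 / 2) ^ n" for n
    unfolding \<epsilon>_def by (simp add: divide_le_eq one_le_power)
  have H_mono: "H j \<le> H k" if "j \<le> k" for j k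
    unfolding H_def using that \<gamma>0 by (intro sum_mono2) auto
  \<comment> \<open>A general family \<open>a\<close> is needed because the estimate is used for
    \<open>\<beta>\<close> and for the truncations of each \<open>g n\<close>.\<close>
  have sq_from_increments: "(\<integral>x. u x * (a m x)\<^sup>2 \<partial>M)
      \<le> (\<Sum>j<m. 2 * real (Suc j) * ((\<integral>x. u x * a (Suc j) x \<partial>M) - (\<integral>x. u x * a j x \<partial>M)))"
    if int: "\<And>j. integrable M (\<lambda>x. u x * a j x)" "integrable M (\<lambda>x. u x * (a m x)\<^sup>2)"
      and a: "\<And>j x. x \<in> space M \<Longrightarrow> 0 \<le> a j x" "\<And>j x. x \<in> space M \<Longrightarrow> a j x \<le> real j"
        "\<And>j x. x \<in> space M \<Longrightarrow> a j x \<le> a (Suc j) x"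
    for a :: "nat \<Rightarrow> 'a \<Rightarrow> real" and m
  proof -
    have "(\<integral>x. u x * (a m x)\<^sup>2 \<partial>M)
        \<le> (\<integral>x. (\<Sum>j<m. 2 * real (Suc j) * (u x * a (Suc j) x - u x * a j x)) \<partial>M)"
    proof (rule integral_mono)
      show "integrable M (\<lambda>x. \<Sum>j<m. 2 * real (Suc j) * (u x * a (Suc j) x - u x * a j x))"
        by (intro Bochner_Integration.integrable_sum integrable_mult_right
              Bochner_Integration.integrable_diff int)
      fix x assume x: "x \<in> space M"
      have "u x * (a m x)\<^sup>2 \<le> u x * (\<Sum>j<m. 2 * real (Suc j) * (a (Suc j) x - a j x))"
        by (intro mult_left_mono square_le_sum_increments a x u_nonneg)
      also have "\<dots> = (\<Sum>j<m. 2 * real (Suc j) * (u x * a (Suc j) x - u x * a j x))"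
        unfolding sum_distrib_left by (intro sum.cong refl) (simp add: algebra_simps)
      finally show "u x * (a m x)\<^sup>2 \<le> (\<Sum>j<m. 2 * real (Suc j) * (u x * a (Suc j) x - u x * a j x))" .
    qed (rule int)
    also have "\<dots> = (\<Sum>j<m. 2 * real (Suc j) * ((\<integral>x. u x * a (Suc j) x \<partial>M) - (\<integral>x. u x * a j x \<partial>M)))"
      by (subst Bochner_Integration.integral_sum)
         (auto simp del: of_nat_Suc intro!: Bochner_Integration.integrable_diff int sum.cong
            simp: Bochner_Integration.integral_diff int)
    finally show ?thesis .
  qed
  have \<beta>2: "(\<integral>x. u x * (\<beta> j x)\<^sup>2 \<partial>M) \<le> H j" for j
    unfolding H_def \<gamma>_def
    by (rule sq_from_increments) (auto intro: int_\<beta> int_\<beta>2 \<beta>_nonneg \<beta>_le \<beta>_mono)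
  have incr: "(\<integral>x. u x * min (g n x) (real (Suc j)) \<partial>M) - (\<integral>x. u x * min (g n x) (real j) \<partial>M)
      \<le> \<gamma> j + 2 * \<epsilon> n" if "Suc j \<le> n" for n j
    using close[OF that] close[of j n] that unfolding \<gamma>_def \<epsilon>_def by linarith
  have g2: "(\<integral>x. u x * (min (g n x) (real j))\<^sup>2 \<partial>M) \<le> H j + 4" if jn: "j \<le> n" for n j
  proof -
    have "(\<integral>x. u x * (min (g n x) (real j))\<^sup>2 \<partial>M) \<le> (\<Sum>i<j. 2 * real (Suc i) *
      ((\<integral>x. u x * min (g n x) (real (Suc i)) \<partial>M) - (\<integral>x. u x * min (g n x) (real i) \<partial>M)))"
      by (rule sq_from_increments) (auto intro: int_g int_g2 g_nonneg simp: g_nonneg)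
    also have "\<dots> \<le> (\<Sum>i<j. 2 * real (Suc i) * (\<gamma> i + 2 * \<epsilon> n))"
      by (intro sum_mono mult_left_mono incr) (use jn in auto)
    also have "\<dots> = H j + (\<Sum>i<j. 4 * real (Suc i) * \<epsilon> n)"
      unfolding H_def sum.distrib[symmetric] by (intro sum.cong refl) (simp add: algebra_simps)
    also have "(\<Sum>i<j. 4 * real (Suc i) * \<epsilon> n) \<le> (\<Sum>i<j. 4 * real (Suc n) * \<epsilon> n)"
      by (intro sum_mono mult_right_mono) (use jn \<epsilon>0 in auto)
    also have "\<dots> = real j * (4 * real (Suc n) * \<epsilon> n)" by simp
    also have "\<dots> \<le> real (Suc n) * (4 * real (Suc n) * \<epsilon> n)"
      by (intro mult_right_mono) (use jn \<epsilon>0[of n] in auto)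
    also have "\<dots> = 4 * (1 / 2) ^ n"
      by (simp add: \<epsilon>_def power2_eq_square del: of_nat_Suc)
    also have "\<dots> \<le> 4" by (simp add: power_le_one)
    finally show ?thesis by simp
  qed
  have trunc: "AE x in M. 0 < u x \<longrightarrow>
    (\<lambda>n. (\<Sum>k=1..n. min (g (\<sigma> k) x) (real (m k))) / real n) \<longlonglongrightarrow> B x"
  proof (rule truncated_strong_law[OF \<sigma>])
    show "m k \<le> \<sigma> k" for k by (simp add: m_def)
    \<comment> \<open>The bound arises as \<open>2 * (H k + 4) + 2 * H k\<close>, from splitting the
      square of the difference and from the estimates \<open>g2\<close> and
      \<open>\<beta>2\<close>.\<close>
    show "(\<integral>x. u x * (min (g (\<sigma> k) x) (real (m k)) - \<beta> (m k) x)\<^sup>2 \<partial>M) \<le> 4 * H k + 8" for k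
    proof -
      have "(\<integral>x. u x * (min (g (\<sigma> k) x) (real (m k)) - \<beta> (m k) x)\<^sup>2 \<partial>M)
        \<le> (\<integral>x. 2 * (u x * (min (g (\<sigma> k) x) (real (m k)))\<^sup>2) + 2 * (u x * (\<beta> (m k) x)\<^sup>2) \<partial>M)"
      proof (rule integral_mono)
        show "integrable M (\<lambda>x. u x * (min (g (\<sigma> k) x) (real (m k)) - \<beta> (m k) x)\<^sup>2)"
          by (rule integrable_weighted[of _ "(real (m k))\<^sup>2"])
             (auto simp: diff_truncation_square_le)
        show "integrable M (\<lambda>x. 2 * (u x * (min (g (\<sigma> k) x) (real (m k)))\<^sup>2) + 2 * (u x * (\<beta> (m k) x)\<^sup>2))"
          by (intro Bochner_Integration.integrable_add integrable_mult_right int_g2 int_\<beta>2)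
        fix x
        have "(p - q)\<^sup>2 \<le> 2 * p\<^sup>2 + 2 * q\<^sup>2" for p q :: real
          using zero_le_power2[of "p + q"] by (simp add: power2_eq_square algebra_simps)
        from mult_left_mono[OF this u_nonneg]
        show "u x * (min (g (\<sigma> k) x) (real (m k)) - \<beta> (m k) x)\<^sup>2
            \<le> 2 * (u x * (min (g (\<sigma> k) x) (real (m k)))\<^sup>2) + 2 * (u x * (\<beta> (m k) x)\<^sup>2)"
          by (simp add: distrib_left mult.left_commute)
      qed
      also have "\<dots> = 2 * (\<integral>x. u x * (min (g (\<sigma> k) x) (real (m k)))\<^sup>2 \<partial>M)
          + 2 * (\<integral>x. u x * (\<beta> (m k) x)\<^sup>2 \<partial>M)"
        by (subst Bochner_Integration.integral_add) (auto intro!: int_g2 int_\<beta>2)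
      also have "\<dots> \<le> 2 * (H (m k) + 4) + 2 * H (m k)"
        by (intro add_mono mult_left_mono g2 \<beta>2) (auto simp: m_def)
      also have "\<dots> \<le> 4 * H k + 8" using H_mono[of "m k" k] by (simp add: m_def)
      finally show ?thesis .
    qed
    have "summable (\<lambda>k. 4 * (H k / (real k)\<^sup>2) + 8 * inverse ((real k)\<^sup>2))"
      unfolding H_def
      by (intro summable_add summable_mult summable_weighted_increments[OF \<gamma>0 sum_\<gamma>]
            inverse_power_summable) simp
    then show "summable (\<lambda>k. (4 * H k + 8) / (real k)\<^sup>2)"
      by (simp add: add_divide_distrib field_simps)
    show "(\<lambda>k. \<beta> (m k) x) \<longlonglongrightarrow> B x" if "x \<in> space M" "0 < u x" for x
    proof (rule filterlim_compose[OF conv[OF that]])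
      show "filterlim m at_top sequentially"
        using filterlim_inj_on_at_top[OF \<sigma>]
        unfolding m_def filterlim_at_top
        by (auto intro: eventually_conj eventually_ge_at_top simp: eventually_conj_iff)
    qed
  qed
  define A where "A k = {x \<in> space M. real (m k) < g (\<sigma> k) x}" for k
  have A[measurable]: "A k \<in> sets M" for k unfolding A_def by measurable
  let ?N = "density M (\<lambda>x. ennreal (u x))"
  have fin: "finite_measure ?N"
  proof
    have "emeasure ?N (space ?N) \<le> (\<integral>\<^sup>+x. 1 \<partial>M)"
      by (simp add: emeasure_density del: nn_integral_const, intro nn_integral_mono)
         (use u_le in \<open>auto simp: indicator_def\<close>)
    then show "emeasure ?N (space ?N) \<noteq> \<infinity>" by (auto simp: emeasure_space_1 top_unique)
  qed
  have measure_A: "measure ?N (A k) = (\<integral>x. u x * indicator (A k) x \<partial>M)" for k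
  proof -
    have "measure ?N (A k) = (\<integral>x. indicator (A k) x \<partial>?N)"
      using finite_measure.emeasure_finite[OF fin, of "A k"] by simp
    also have "\<dots> = (\<integral>x. u x * indicator (A k) x \<partial>M)"
      by (subst integral_density) (auto simp: u_nonneg)
    finally show ?thesis .
  qed
  \<comment> \<open>The index is shifted because exceeding level \<open>Suc i\<close> forces a full
    unit increment of the truncations from level \<open>i\<close> to \<open>Suc i\<close>, which is
    estimated by \<open>\<gamma> i\<close>. At level 0 only the trivial bound 1 remains.\<close>
  define \<tau> where "\<tau> j = (case j of 0 \<Rightarrow> 1 | Suc i \<Rightarrow> \<gamma> i)" for j
  have \<tau>0: "0 \<le> \<tau> j" for j by (simp add: \<tau>_def \<gamma>0 split: nat.split)
  have summable_\<tau>: "summable \<tau>"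
    using summable_\<gamma> by (subst summable_Suc_iff[symmetric]) (simp add: \<tau>_def)
  have A_le: "measure ?N (A k) \<le> \<tau> (m k) + 2 * \<epsilon> (\<sigma> k)" for k
  proof (cases "m k")
    case 0
    have "(\<integral>x. u x * indicator (A k) x \<partial>M) \<le> (\<integral>x. 1 \<partial>M)"
      by (rule integral_mono[OF integrable_weighted[of _ 1]])
         (use u_nonneg u_le in \<open>auto simp: indicator_def\<close>)
    then show ?thesis using 0 \<epsilon>0[of "\<sigma> k"] by (simp add: measure_A \<tau>_def prob_space)
  next
    case (Suc j)
    have "(\<integral>x. u x * indicator (A k) x \<partial>M)
        \<le> (\<integral>x. u x * min (g (\<sigma> k) x) (real (Suc j)) - u x * min (g (\<sigma> k) x) (real j) \<partial>M)"
    proof (rule integral_mono[OF integrable_weighted[of _ 1]])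
      fix x
      have "indicator (A k) x \<le> min (g (\<sigma> k) x) (real (Suc j)) - min (g (\<sigma> k) x) (real j)"
        by (auto simp: indicator_def A_def Suc min_def)
      from mult_left_mono[OF this u_nonneg]
      show "u x * indicator (A k) x
          \<le> u x * min (g (\<sigma> k) x) (real (Suc j)) - u x * min (g (\<sigma> k) x) (real j)"
        by (simp add: right_diff_distrib)
    qed (auto intro!: Bochner_Integration.integrable_diff int_g simp del: of_nat_Suc)
    also have "\<dots> \<le> \<gamma> j + 2 * \<epsilon> (\<sigma> k)"
      using incr[of j "\<sigma> k"] Suc
      by (subst Bochner_Integration.integral_diff) (auto intro: int_g simp: m_def simp del: of_nat_Suc)
    finally show ?thesis using Suc by (simp add: measure_A \<tau>_def)
  qed
  have "summable (\<lambda>k. measure ?N (A k))"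
  proof (rule summableI_nonneg_bounded)
    fix n
    \<comment> \<open>Position 0 is split off because injectivity of \<open>\<sigma>\<close> is
      given only from 1 on.\<close>
    have "(\<Sum>k<n. measure ?N (A k)) \<le> measure ?N (A 0) + (\<Sum>k=1..n. measure ?N (A k))"
    proof -
      have "(\<Sum>k<n. measure ?N (A k)) \<le> (\<Sum>k\<in>insert 0 {1..n}. measure ?N (A k))"
        by (intro sum_mono2) auto
      then show ?thesis by simp
    qed
    \<comment> \<open>The level \<open>m k\<close> is either \<open>k\<close> or
      \<open>\<sigma> k\<close>, and \<open>\<tau>\<close> is not assumed monotone, so both values
      are added; each sum runs through the terms of a convergent series at most once.\<close>
    also have "(\<Sum>k=1..n. measure ?N (A k))
        \<le> (\<Sum>k=1..n. \<tau> k + (\<tau> (\<sigma> k) + 2 * (1 / 2) ^ \<sigma> k))"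
    proof (rule sum_mono)
      fix k
      show "measure ?N (A k) \<le> \<tau> k + (\<tau> (\<sigma> k) + 2 * (1 / 2) ^ \<sigma> k)"
        using A_le[of k] \<tau>0[of k] \<tau>0[of "\<sigma> k"] \<epsilon>_le[of "\<sigma> k"] by (simp add: m_def min_def split: if_splits)
    qed
    also have "\<dots> \<le> suminf \<tau> + suminf (\<lambda>i. \<tau> i + 2 * (1 / 2) ^ i)"
      unfolding sum.distrib[of \<tau>]
      using \<tau>0
      by (intro add_mono sum_le_suminf sum_inj_on_le_suminf[OF \<sigma>, of "\<lambda>i. \<tau> i + 2 * (1 / 2) ^ i"]
            summable_\<tau> summable_add summable_mult summable_geometric) auto
    finally show "(\<Sum>k<n. measure ?N (A k)) \<le> measure ?N (A 0) + (suminf \<tau> + suminf (\<lambda>i. \<tau> i + 2 * (1 / 2) ^ i))"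
      by simp
  qed simp
  then have "AE x in ?N. eventually (\<lambda>k. x \<in> space ?N - A k) sequentially"
    using finite_measure.emeasure_finite[OF fin]
    by (intro borel_cantelli_AE1) (auto simp: less_top)
  then have "AE x in M. 0 < u x \<longrightarrow> eventually (\<lambda>k. x \<in> space M - A k) sequentially"
    by (subst (asm) AE_density) auto
  with trunc show ?thesis
  proof eventually_elim
    case (elim x)
    show ?case
    proof
      assume u: "0 < u x"
      let ?d = "\<lambda>k. g (\<sigma> k) x - min (g (\<sigma> k) x) (real (m k))"
      have "?d \<longlonglongrightarrow> 0"
        by (rule tendsto_eventually)
           (use elim(2) u in \<open>auto elim!: eventually_mono simp: A_def min_def\<close>)
      from tendsto_add[OF tendsto_average[OF this] elim(1)[rule_format, OF u]]
      show "(\<lambda>n. (\<Sum>k=1..n. g (\<sigma> k) x) / real n) \<longlonglongrightarrow> B x"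
        by (simp add: sum_subtractf diff_divide_distrib)
    qed
  qed
qed

end

section \<open>Selecting the subsequence and identifying the limit\<close>

text \<open>The weight and the factor with fixed \<open>a\<close> form a bounded, hence integrable,
  test function; centring the other factor makes its weak limit 0.\<close>

lemma (in finite_measure) eventually_orthogonal_truncations:
  fixes f \<beta> :: "nat \<Rightarrow> 'a \<Rightarrow> real" and u :: "'a \<Rightarrow> real" and k l :: nat
  assumes [measurable]: "\<And>n. f n \<in> borel_measurable M" "\<And>k. \<beta> k \<in> borel_measurable M"
      "u \<in> borel_measurable M"
    and f0: "\<And>n x. x \<in> space M \<Longrightarrow> 0 \<le> f n x"
    and \<beta>: "\<And>k x. 0 \<le> \<beta> k x" "\<And>k x. \<beta> k x \<le> real k"
    and u: "\<And>x. 0 \<le> u x" "\<And>x. u x \<le> 1"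
    and lim: "\<And>k \<phi>. integrable M \<phi> \<Longrightarrow>
       ((\<lambda>n. \<integral>x. \<phi> x * min (f n x) (real k) \<partial>M) \<longlongrightarrow> (\<integral>x. \<phi> x * \<beta> k x \<partial>M)) F"
    and e: "e > 0"
  shows "\<forall>\<^sub>F b in F. \<bar>\<integral>x. u x * ((min (f a x) (real k) - \<beta> k x) * (min (f b x) (real l) - \<beta> l x)) \<partial>M\<bar> \<le> e"
proof -
  define \<phi> where "\<phi> x = u x * (min (f a x) (real k) - \<beta> k x)" for x
  have [measurable]: "\<phi> \<in> borel_measurable M" unfolding \<phi>_def by measurable
  have \<phi>_le: "\<bar>\<phi> x\<bar> \<le> real k" if "x \<in> space M" for x
  proof -
    have "\<bar>min (f a x) (real k) - \<beta> k x\<bar> \<le> real k"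
      using f0[OF that, of a] \<beta>(1)[of k x] \<beta>(2)[of k x] by (auto simp: abs_le_iff min_def)
    then show ?thesis
      using mult_mono[OF u(2)[of x], of "\<bar>min (f a x) (real k) - \<beta> k x\<bar>" "real k"] u(1)[of x]
      by (simp add: \<phi>_def abs_mult)
  qed
  have int: "integrable M \<phi>"
    by (rule integrable_const_bound[of _ "real k"]) (auto intro!: AE_I2 \<phi>_le)
  have int_mult: "integrable M (\<lambda>x. \<phi> x * z x)"
    if [measurable]: "z \<in> borel_measurable M" and z: "\<And>x. x \<in> space M \<Longrightarrow> \<bar>z x\<bar> \<le> real l" for z
    by (rule integrable_const_bound[of _ "real k * real l"])
       (auto intro!: AE_I2 mult_mono \<phi>_le z simp: abs_mult)
  have "(\<integral>x. \<phi> x * (min (f b x) (real l) - \<beta> l x) \<partial>M)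
      = (\<integral>x. \<phi> x * min (f b x) (real l) \<partial>M) - (\<integral>x. \<phi> x * \<beta> l x \<partial>M)" for b
    unfolding right_diff_distrib
    by (rule Bochner_Integration.integral_diff; rule int_mult) (auto simp: f0 \<beta>)
  with LIM_zero[OF lim[OF int, of l]]
  have "((\<lambda>b. \<integral>x. \<phi> x * (min (f b x) (real l) - \<beta> l x) \<partial>M) \<longlongrightarrow> 0) F"
    by simp
  from tendstoD[OF this e] show ?thesis
    by eventually_elim (simp add: \<phi>_def mult.assoc)
qed

text \<open>Injections are quantified because they comprise both the passage to a further
  subsequence and its permutation.\<close>

lemma (in prob_space) ex_subsequence_average_converges:
  fixes f :: "nat \<Rightarrow> 'a \<Rightarrow> real"
  assumes f[measurable]: "\<And>n. f n \<in> borel_measurable M"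
    and f0: "\<And>n x. x \<in> space M \<Longrightarrow> 0 \<le> f n x"
  shows "\<exists>(G :: 'a \<Rightarrow> ennreal) s. G \<in> borel_measurable M \<and> strict_mono s \<and>
    (\<forall>\<sigma> :: nat \<Rightarrow> nat. inj_on \<sigma> {1..} \<longrightarrow>
      (AE x in M. (\<lambda>n. ennreal ((\<Sum>k=1..n. f (s (\<sigma> k)) x) / real n)) \<longlonglongrightarrow> G x))"
proof -
  obtain F \<beta> where F: "F \<noteq> bot" "F \<le> sequentially"
    and \<beta>[measurable]: "\<And>k. \<beta> k \<in> borel_measurable M"
    and \<beta>0: "\<And>k x. 0 \<le> \<beta> k x" and \<beta>_le: "\<And>k x. \<beta> k x \<le> real k"
    and \<beta>_mono: "\<And>j k x. j \<le> k \<Longrightarrow> \<beta> j x \<le> \<beta> k x"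
    and lim: "\<And>k \<phi>. integrable M \<phi> \<Longrightarrow>
       ((\<lambda>n. \<integral>x. \<phi> x * min (f n x) (real k) \<partial>M) \<longlongrightarrow> (\<integral>x. \<phi> x * \<beta> k x \<partial>M)) F"
    by (rule ex_truncation_limits[of f, OF f f0]) blast+
  define G where "G x = (SUP k. ennreal (\<beta> k x))" for x
  have G[measurable]: "G \<in> borel_measurable M" unfolding G_def by measurable
  \<comment> \<open>The weight has the null sets of \<open>{G < \<infinity>}\<close> and makes all \<open>w \<beta>\<^sub>k\<close> bounded by 1, so no
    \<open>L\<^sup>1\<close> bound on \<open>f\<close> is needed.\<close>
  define w where "w x = (if G x = \<top> then 0 else 1 / (1 + enn2real (G x)))" for x
  have w[measurable]: "w \<in> borel_measurable M" unfolding w_def by measurable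
  have w0: "0 \<le> w x" and w1: "w x \<le> 1" for x
    by (auto simp: w_def divide_le_eq add_pos_nonneg)
  have w_pos: "0 < w x \<longleftrightarrow> G x \<noteq> \<top>" for x
    by (auto simp: w_def intro!: divide_pos_pos add_pos_nonneg)
  have \<beta>_G: "\<beta> k x \<le> enn2real (G x)" if "G x \<noteq> \<top>" for k x
  proof -
    have "ennreal (\<beta> k x) \<le> G x" unfolding G_def by (rule SUP_upper) simp
    from enn2real_mono[OF this] that show ?thesis by (simp add: less_top \<beta>0)
  qed
  have w\<beta>: "w x * \<beta> k x \<le> 1" for k x
    using \<beta>_G[of x k] \<beta>0[of k x] by (auto simp: w_def divide_le_eq)
  have \<beta>_conv: "(\<lambda>k. \<beta> k x) \<longlonglongrightarrow> enn2real (G x)" if "G x \<noteq> \<top>" for x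
  proof -
    have "(\<lambda>k. ennreal (\<beta> k x)) \<longlonglongrightarrow> G x"
      unfolding G_def by (rule LIMSEQ_SUP) (auto simp: incseq_def \<beta>_mono ennreal_leI)
    then have "(\<lambda>k. ennreal (\<beta> k x)) \<longlonglongrightarrow> ennreal (enn2real (G x))"
      using that by (simp add: less_top)
    from tendsto_enn2real[OF this] show ?thesis by (simp add: \<beta>0)
  qed
  \<comment> \<open>Both weights enter the selection, since the same subsequence has to serve where
    \<open>G\<close> is finite and where it is infinite.\<close>
  define D where "D i a n b \<longleftrightarrow> (\<forall>u\<in>{\<lambda>_. 1, w}. \<forall>k\<in>{..i}. \<forall>l\<in>{..n}.
    \<bar>\<integral>x. u x * ((min (f a x) (real k) - \<beta> k x) * (min (f b x) (real l) - \<beta> l x)) \<partial>M\<bar>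
      \<le> (1 / 2) ^ i * (1 / 2) ^ n)" for i a n b
  define E where "E n b \<longleftrightarrow> (\<forall>j\<in>{..n}.
    \<bar>(\<integral>x. w x * min (f b x) (real j) \<partial>M) - (\<integral>x. w x * \<beta> j x \<partial>M)\<bar>
      \<le> (1 / 2) ^ n / (real (Suc n))\<^sup>2)" for n b
  have int_w: "integrable M w"
    by (rule integrable_const_bound[of _ 1]) (auto simp: w0 w1)
  have ev_E: "eventually (E n) F" for n
    unfolding E_def
  proof (intro eventually_ball_finite ballI)
    fix j
    have "(1 / 2 :: real) ^ n / (real (Suc n))\<^sup>2 > 0" by simp
    from tendstoD[OF lim[OF int_w, of j] this]
    show "\<forall>\<^sub>F b in F. \<bar>(\<integral>x. w x * min (f b x) (real j) \<partial>M) - (\<integral>x. w x * \<beta> j x \<partial>M)\<bar>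
      \<le> (1 / 2) ^ n / (real (Suc n))\<^sup>2"
      by eventually_elim (simp add: dist_real_def)
  qed simp
  have ev_D: "eventually (D i a n) F" for i a n
    unfolding D_def
  proof (intro eventually_ball_finite ballI)
    fix u k l assume "u \<in> {\<lambda>_. 1, w}"
    then have u: "u \<in> borel_measurable M" "\<And>x. 0 \<le> u x" "\<And>x. u x \<le> 1"
      by (auto simp: w0 w1)
    show "\<forall>\<^sub>F b in F. \<bar>\<integral>x. u x * ((min (f a x) (real k) - \<beta> k x) * (min (f b x) (real l) - \<beta> l x)) \<partial>M\<bar>
      \<le> (1 / 2) ^ i * (1 / 2) ^ n"
      by (rule eventually_orthogonal_truncations[OF f \<beta> u(1) f0 \<beta>0 \<beta>_le u(2,3) lim]) simp_all
  qed simp_all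
  have "\<exists>s. strict_mono s \<and> (\<forall>n. E n (s n)) \<and> (\<forall>n. \<forall>i<n. D i (s i) n (s n))"
    by (rule ex_strict_mono_select[OF F]) (rule ev_E ev_D)+
  then obtain s where s: "strict_mono s" "\<And>n. E n (s n)" "\<And>i n. i < n \<Longrightarrow> D i (s i) n (s n)"
    by blast
  have orth: "orthogonal_truncations M (\<lambda>n. f (s n)) \<beta> u" if u: "u \<in> {\<lambda>_. 1, w}" for u
  proof
    show "u \<in> borel_measurable M" "\<And>x. 0 \<le> u x" "\<And>x. u x \<le> 1"
      using u by (auto simp: w0 w1)
    show "\<bar>\<integral>x. u x * ((min (f (s i) x) (real k) - \<beta> k x) * (min (f (s n) x) (real l) - \<beta> l x)) \<partial>M\<bar>
        \<le> (1 / 2) ^ i * (1 / 2) ^ n" if "i < n" "k \<le> i" "l \<le> n" for i n k l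
      by (rule s(3)[OF that(1), unfolded D_def, rule_format, OF u]) (use that in simp_all)
  qed (simp_all add: f0 \<beta>0 \<beta>_le \<beta>_mono)
  interpret unit: orthogonal_truncations M "\<lambda>n. f (s n)" \<beta> "\<lambda>_. 1" by (rule orth) simp
  interpret w: orthogonal_truncations M "\<lambda>n. f (s n)" \<beta> w by (rule orth) simp
  have "AE x in M. (\<lambda>n. ennreal ((\<Sum>k=1..n. f (s (\<sigma> k)) x) / real n)) \<longlonglongrightarrow> G x"
    if \<sigma>: "inj_on \<sigma> {1..}" for \<sigma> :: "nat \<Rightarrow> nat"
  proof -
    have "(\<integral>x. w x * \<beta> k x \<partial>M) \<le> 1" for k
    proof -
      have "(\<integral>x. w x * \<beta> k x \<partial>M) \<le> (\<integral>x. 1 \<partial>M)"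
        by (rule integral_mono) (auto intro!: integrable_const_bound[of _ 1] simp: w\<beta> w0 \<beta>0)
      then show ?thesis by (simp add: prob_space)
    qed
    then have fin: "AE x in M. 0 < w x \<longrightarrow>
        (\<lambda>n. (\<Sum>k=1..n. f (s (\<sigma> k)) x) / real n) \<longlonglongrightarrow> enn2real (G x)"
      by (rule w.untruncated_strong_law[OF \<sigma>])
         (use s(2) in \<open>auto simp: E_def w_pos intro!: \<beta>_conv\<close>)
    \<comment> \<open>Weight 1 reaches also the points with \<open>G x = \<top>\<close>, where
      \<open>w\<close> vanishes; the levels are countable, so one null set suffices for all of
      them.\<close>
    have "AE x in M. \<forall>m. (\<lambda>n. (\<Sum>k=1..n. min (f (s (\<sigma> k)) x) (real (min m (\<sigma> k)))) / real n)
        \<longlonglongrightarrow> \<beta> m x"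
      unfolding AE_all_countable using unit.fixed_level_law[OF \<sigma>] by simp
    with fin show ?thesis
    proof eventually_elim
      case (elim x)
      let ?A = "\<lambda>n. (\<Sum>k=1..n. f (s (\<sigma> k)) x) / real n"
      show ?case
      proof (cases "G x = \<top>")
        case False
        with elim(1) have "?A \<longlonglongrightarrow> enn2real (G x)" by (simp add: w_pos)
        then have "(\<lambda>n. ennreal (?A n)) \<longlonglongrightarrow> ennreal (enn2real (G x))" by (rule tendsto_ennrealI)
        then show ?thesis using False by (simp add: less_top)
      next
        case True
        \<comment> \<open>Every level bounds the averages from below, asymptotically by
          \<open>\<beta> m x\<close>, and these bounds have supremum \<open>\<top>\<close>
          here.\<close>
        have "filterlim ?A at_top sequentially"
          unfolding filterlim_at_top
        proof
          fix Z :: real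
          have "ennreal Z < G x" by (simp add: True)
          then obtain m where "ennreal Z < ennreal (\<beta> m x)" unfolding G_def less_SUP_iff by blast
          then have "Z < \<beta> m x" by (meson ennreal_leI not_less)
          with elim(2) have "\<forall>\<^sub>F n in sequentially.
              Z < (\<Sum>k=1..n. min (f (s (\<sigma> k)) x) (real (min m (\<sigma> k)))) / real n"
            by (auto intro: order_tendstoD(1))
          then show "\<forall>\<^sub>F n in sequentially. Z \<le> ?A n"
          proof eventually_elim
            case (elim n)
            also have "(\<Sum>k=1..n. min (f (s (\<sigma> k)) x) (real (min m (\<sigma> k)))) / real n \<le> ?A n"
              by (intro divide_right_mono sum_mono) auto
            finally show ?case by simp
          qed
        qed
        then show ?thesis using True by (simp add: ennreal_tendsto_top_eq_at_top)
      qed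
    qed
  qed
  with G s(1) show ?thesis by blast
qed

theorem theorem1p1:
  fixes M :: "'a measure" and f :: "nat \<Rightarrow> 'a \<Rightarrow> real"
  assumes "prob_space M"
    and "\<And>n. n \<ge> 1 \<Longrightarrow> f n \<in> borel_measurable M"
    and "\<And>n x. n \<ge> 1 \<Longrightarrow> x \<in> space M \<Longrightarrow> 0 \<le> f n x"
  shows "\<exists>(F :: 'a \<Rightarrow> ennreal) (g :: nat \<Rightarrow> 'a \<Rightarrow> real).
           F \<in> borel_measurable M \<and> subsequence_of g f \<and>
           (\<forall>(h :: nat \<Rightarrow> 'a \<Rightarrow> real) (\<pi> :: nat \<Rightarrow> nat).
              subsequence_of h g \<longrightarrow> bij_betw \<pi> {1..} {1..} \<longrightarrow>
              (AE x in M. (\<lambda>n. ennreal (1 / real n * (\<Sum>k=1..n. h (\<pi> k) x))) \<longlonglongrightarrow> F x))"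
proof -
  interpret prob_space M by fact
  \<comment> \<open>The shift by one discards \<open>f 0\<close>, about which nothing is
    assumed.\<close>
  have "f (Suc n) \<in> borel_measurable M" "x \<in> space M \<Longrightarrow> 0 \<le> f (Suc n) x" for n x
    using assms(2,3) by simp_all
  from ex_subsequence_average_converges[of "\<lambda>n. f (Suc n)", OF this]
  obtain F :: "'a \<Rightarrow> ennreal" and s where F: "F \<in> borel_measurable M" and s: "strict_mono s"
    and conv: "\<And>\<sigma> :: nat \<Rightarrow> nat. inj_on \<sigma> {1..} \<Longrightarrow>
      AE x in M. (\<lambda>n. ennreal ((\<Sum>k=1..n. f (Suc (s (\<sigma> k))) x) / real n)) \<longlonglongrightarrow> F x"
    by blast
  define g where "g n = f (Suc (s n))" for n
  have "subsequence_of g f"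
    unfolding subsequence_of_def
    by (rule exI[of _ "\<lambda>n. Suc (s n)"]) (use s in \<open>auto simp: g_def strict_mono_on_def strict_mono_def\<close>)
  moreover have "AE x in M. (\<lambda>n. ennreal (1 / real n * (\<Sum>k=1..n. h (\<pi> k) x))) \<longlonglongrightarrow> F x"
    if h: "subsequence_of h g" and \<pi>: "bij_betw \<pi> {1..} {1..}" for h and \<pi> :: "nat \<Rightarrow> nat"
  proof -
    obtain r where r: "strict_mono_on {1..} r" "\<And>n. n \<ge> 1 \<Longrightarrow> h n = g (r n)"
      using h unfolding subsequence_of_def by blast
    \<comment> \<open>The further subsequence and the permutation merge into a single injection of
      positions into indices of \<open>g\<close>.\<close>
    have "inj_on (r \<circ> \<pi>) {1..}"
      using \<pi> strict_mono_on_imp_inj_on[OF r(1)]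
      by (intro comp_inj_on) (auto simp: bij_betw_def)
    from conv[OF this] show ?thesis
    proof eventually_elim
      case (elim x)
      have "\<pi> k \<ge> 1" if "k \<ge> 1" for k
        using \<pi> that by (auto simp: bij_betw_def)
      then have "1 / real n * (\<Sum>k=1..n. h (\<pi> k) x) = (\<Sum>k=1..n. f (Suc (s ((r \<circ> \<pi>) k))) x) / real n" for n
        by (simp add: r(2) g_def)
      with elim show ?case by (simp only:)
    qed
  qed
  ultimately show ?thesis using F by blast
qed

end
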